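(* Let $\theta>0$ and let $s:[0,\infty)\to[0,\infty)$ be locally absolutely continuous on $[0,\infty)$, strictly increasing with $s(0)=0$ and $s(1)=1$, satisfying $s(x+1)\le s(x)+1$ for all $x\ge0$ and $|s(x+1)-s(y+1)|\le|s(x)-s(y)|$ for all $x,y\ge0$. Assume that $\mu=E[D_{\theta,s}]$ exists (is finite). Let $t(x)=s^\theta(x)$, and suppose there exists $\rho\in[0,1)$ such that $$\operatorname*{ess\,sup}_{x>0}I(x)\le\rho,\qquad\text{where}\qquad I(x)=\frac{t'(x)}{t^2(x)}\int_0^xt(u)\,du.$$ Then for all $a\ge0$ and all $h:[0,\infty)\to\mathbb{R}$ with $h\in\mathrm{Lip}_1$ and $E[h(D_{\theta,s})]=0$, the following hold, where $h^{(\star k)}(x)=A_{x+1}^kh$, $g_n(x)=\sum_{k=0}^nh^{(\star k)}(x)$ and $g(x)=\sum_{k\ge0}h^{(\star k)}(x)$: $$\sup_{x\in[0,a]}|h^{(\star k)}(x)|\le(\mu+a)\rho^k\quad\text{for all }k\ge0;$$ $g_n\in\mathrm{Lip}_{(1-\rho^{n+1})/(1-\rho)}$ for all $n\ge0$; and $g\in\mathrm{Lip}_{1/(1-\rho)}$ is a solution of $$g(x)-A_{x+1}g=h(x)-E[h(D_{\theta,s})].$$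
   Context: A function on $[0,\infty)$ is locally absolutely continuous if it is absolutely continuous on every compact subinterval. $\mathrm{Lip}_\alpha$ is the set of real-valued functions $h$ with $|h(x)-h(y)|\le\alpha|x-y|$ for all $x,y$ in the domain. $D_{\theta,s}$ denotes a random variable whose law is the unique law of a non-negative random variable $D$ such that $s(D)$ has finite mean and $D=_ds^{-1}(U^{1/\theta}s(D+1))$ with $U\sim\mathcal{U}[0,1]$ independent of $D$, where $=_d$ is equality in distribution (this law exists and is unique under the stated conditions on $s$). Averaging operator: for $h$ integrable on $[0,a]$ with respect to the measure $t'(v)\,dv$, $$A_xh=\frac{1}{t(x)}\int_0^xh(v)t'(v)\,dv\ \text{ for }x\in(0,a],\qquad A_0h=h(0)\mathbf{1}(t(0)=0).$$ Its iterates are defined by $A_{x+1}^0h=h(x)$ and $A_{x+1}^nh=A_{x+1}\big(A_{\cdot+1}^{n-1}h\big)$ for $n\ge1$, i.e. the operator $A_{x+1}$ is applied to the function $y\mapsto A_{y+1}^{n-1}h$. *)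

theory Defs
  imports "HOL-Probability.Probability"
begin

definition abs_cont_on :: "real \<Rightarrow> real \<Rightarrow> (real \<Rightarrow> real) \<Rightarrow> bool" where
  "abs_cont_on a b f \<longleftrightarrow>
     (\<forall>\<epsilon>>0. \<exists>\<delta>>0. \<forall>P :: (real \<times> real) set.
        finite P \<and> (\<forall>(u, v)\<in>P. a \<le> u \<and> u < v \<and> v \<le> b) \<and>
        pairwise (\<lambda>p q. disjnt {fst p<..<snd p} {fst q<..<snd q}) P \<and>
        (\<Sum>(u, v)\<in>P. v - u) < \<delta>
        \<longrightarrow> (\<Sum>(u, v)\<in>P. \<bar>f v - f u\<bar>) < \<epsilon>)"

(* Functions on [0, oo) are represented by total functions real => real; every notion
   below depends only on their values on [0, oo). *)

definition locally_abs_cont :: "(real \<Rightarrow> real) \<Rightarrow> bool" where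
  "locally_abs_cont f \<longleftrightarrow> (\<forall>a b. 0 \<le> a \<and> a \<le> b \<longrightarrow> abs_cont_on a b f)"

(* D is non-negative, s(D) has finite mean, and D has the same law as
   s^{-1} (U^{1/theta} s(D + 1)), where U is uniform on [0, 1] and independent of D.
   Independence is realised on the product space: u plays the role of U and w is the sample
   point of D.  The inverse of s is taken on [0, oo). *)
definition perpetuity_rv :: "real \<Rightarrow> (real \<Rightarrow> real) \<Rightarrow> 'a measure \<Rightarrow> ('a \<Rightarrow> real) \<Rightarrow> bool" where
  "perpetuity_rv \<theta> s M D \<longleftrightarrow>
     prob_space M \<and> D \<in> borel_measurable M \<and> (\<forall>w\<in>space M. 0 \<le> D w) \<and>
     integrable M (\<lambda>w. s (D w)) \<and>
     distr M borel D =
       distr (uniform_measure lborel {0..1} \<Otimes>\<^sub>M M) borel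
         (\<lambda>(u, w). inv_into {0..} s (u powr (1 / \<theta>) * s (D w + 1)))"

(* The derivative t' of a locally absolutely continuous function exists only almost everywhere;
   deriv takes an unspecified constant value at the remaining points. *)
definition avg_op :: "(real \<Rightarrow> real) \<Rightarrow> (real \<Rightarrow> real) \<Rightarrow> real \<Rightarrow> real" where
  "avg_op t h x =
     (if x = 0 then (if t 0 = 0 then h 0 else 0)
      else 1 / t x * (LINT v:{0..x}|lebesgue. h v * deriv t v))"

(* avg_iter t h k x is the iterate A_{x+1}^k h. *)
fun avg_iter :: "(real \<Rightarrow> real) \<Rightarrow> (real \<Rightarrow> real) \<Rightarrow> nat \<Rightarrow> real \<Rightarrow> real" where
  "avg_iter t h 0 x = h x"
| "avg_iter t h (Suc k) x = avg_op t (\<lambda>y. avg_iter t h k y) (x + 1)"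

definition ratio_I :: "(real \<Rightarrow> real) \<Rightarrow> real \<Rightarrow> real" where
  "ratio_I t x = deriv t x / (t x)\<^sup>2 * (LINT u:{0..x}|lebesgue. t u)"

end

theory Submission
  imports Defs
begin

text \<open>
  Write \<open>E\<^sub>x\<close> for the expectation under the law \<open>K\<^sub>x\<close> on \<open>[0, x]\<close> with density \<open>t' / t(x)\<close>, so that
  \<open>A\<^sub>x h = E\<^sub>x h\<close>. Its quantile function is
  \<open>u \<mapsto> t\<inverse>(u t(x)) = s\<inverse>(u\<^sup>1\<^sup>/\<^sup>\<theta> s(x))\<close>, the map in the fixed-point equation of \<open>D\<close>. This observation
  drives the proof, because it gives the following two facts.

  First, the fixed-point equation says that a point drawn from \<open>K\<^sub>x\<close> with random \<open>x = D + 1\<close>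
  is distributed as \<open>D\<close>.
  Hence \<open>E h(D) = E A\<^bsub>D+1\<^esub> h\<close>, and all iterates of a centred \<open>h\<close> are centred
  (\<open>perpetuity_avg_invariant\<close>).

  Secondly, using the same uniform variable for all \<open>x\<close> couples the laws \<open>K\<^sub>x\<close> monotonically, so
  for \<open>x \<le> y\<close> and a Lipschitz function \<open>h\<close> with constant \<open>L\<close> the difference
  \<open>A\<^sub>y h - A\<^sub>x h\<close> is bounded by \<open>L (G(y) - G(x))\<close>, where \<open>G(x)\<close> is the mean of \<open>K\<^sub>x\<close>
  (\<open>kernel_avg_coupling\<close>). Fubini's theorem gives \<open>G(x) = x - T(x) / t(x)\<close> with
  \<open>T(x) = \<integral>\<^sub>0\<^sup>x t\<close>, whose formal derivative is the ratio \<open>I(x)\<close>. So the hypothesis on \<open>I\<close> makes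
  \<open>G\<close> Lipschitz with constant \<open>\<rho>\<close> (\<open>kernel_avg_id_lipschitz\<close>), and \<open>A\<close> multiplies Lipschitz
  constants by \<open>\<rho>\<close> (\<open>avg_op_lipschitz\<close>).

  Consequently the \<open>k\<close>-th iterate is centred with Lipschitz constant \<open>\<rho>\<^sup>k\<close>, which bounds it at \<open>x\<close>
  by \<open>\<rho>\<^sup>k E|x - D| \<le> \<rho>\<^sup>k (\<mu> + x)\<close>. The series for \<open>g\<close> converges geometrically, its partial sums
  have the geometric Lipschitz constants, and averaging it term by term shifts the index, which is
  the Stein equation.

  The analytic input is that \<open>t'(v) dv\<close> really is the measure with distribution function \<open>t\<close>.
  It comes from two lemmas on absolute continuity: an absolutely continuous distribution function gives
  no mass to null sets (\<open>abs_cont_null\<close>), and then its derivative exists almost everywhere and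
  is the density (\<open>cdf_has_density_derivative\<close>).
\<close>

section \<open>Absolutely continuous distribution functions\<close>

text \<open>
  Covering a null set efficiently by intervals makes its measure small: inside an open
  neighbourhood of small length it is covered by countably many intervals with disjoint
  interiors, and absolute continuity bounds the \<open>K\<close>-mass of any finitely many of
  them, hence, by continuity from below, of all of them.
\<close>

lemma abs_cont_null:
  fixes K :: "real measure"
  assumes fin: "finite_measure K" and sets_K: "sets K = sets borel"
    and F: "abs_cont_on a b F" and ab: "a < b"
    and K: "\<And>u v. a \<le> u \<Longrightarrow> u \<le> v \<Longrightarrow> v \<le> b \<Longrightarrow> measure K {u..v} = F v - F u"
    and N: "N \<in> null_sets lborel"
  shows "emeasure K (N \<inter> {a..b}) = 0"
proof -
  interpret finite_measure K by (rule fin)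
  have Nm: "N \<in> sets borel" using N by auto
  have small: "measure K (N \<inter> {a..b}) \<le> \<epsilon>" if "\<epsilon> > 0" for \<epsilon>
  proof -
    from F[unfolded abs_cont_on_def, rule_format, OF that]
    obtain \<delta> where "\<delta> > 0" and \<delta>: "\<forall>P :: (real \<times> real) set.
        finite P \<and> (\<forall>(u, v)\<in>P. a \<le> u \<and> u < v \<and> v \<le> b) \<and>
        pairwise (\<lambda>p q. disjnt {fst p<..<snd p} {fst q<..<snd q}) P \<and>
        (\<Sum>(u, v)\<in>P. v - u) < \<delta> \<longrightarrow> (\<Sum>(u, v)\<in>P. \<bar>F v - F u\<bar>) < \<epsilon>"
      by (elim exE conjE) (rule that)
    obtain U where U: "open U" "N \<subseteq> U" "emeasure lborel (U - N) < \<delta>"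
      using outer_regular_lborel[OF Nm \<open>\<delta> > 0\<close>] .
    have U_small: "emeasure lborel U < \<delta>"
      using emeasure_Un_null_set[OF _ N, of "U - N"] U Nm
      by (metis Un_Diff_cancel2 Un_absorb2 borel_open sets.Diff sets_lborel)
    \<comment> \<open>the gauge forces the covering intervals, each of which meets \<open>N\<close>, into \<open>U\<close>\<close>
    have "N \<inter> {a..b} \<subseteq> cbox a b" "box a b \<noteq> {}" "gauge (\<lambda>x. if x \<in> N then U else UNIV)"
      using ab U by (auto simp: gauge_def)
    then obtain \<D> where \<D>: "countable \<D>"  "\<Union>\<D> \<subseteq> cbox a b"
        "\<And>I. I \<in> \<D> \<Longrightarrow> interior I \<noteq> {} \<and> (\<exists>c d. I = cbox c d)"
        "pairwise (\<lambda>A B. interior A \<inter> interior B = {}) \<D>"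
        "\<And>I. I \<in> \<D> \<Longrightarrow> \<exists>x \<in> (N \<inter> {a..b}) \<inter> I. I \<subseteq> (if x \<in> N then U else UNIV)"
        "N \<inter> {a..b} \<subseteq> \<Union>\<D>"
      by (rule covering_lemma) blast
    have \<D>U: "\<Union>\<D> \<subseteq> U" using \<D>(5) by fastforce
    have ends: "I = {Inf I..Sup I} \<and> a \<le> Inf I \<and> Inf I < Sup I \<and> Sup I \<le> b" if I: "I \<in> \<D>" for I
    proof -
      from \<D>(3)[OF that] obtain c d where cd: "I = {c..d}" "interior I \<noteq> {}" by (auto simp: cbox_interval)
      then have "c < d" by (auto simp: interior_atLeastAtMost_real)
      moreover have "{c..d} \<subseteq> {a..b}" using \<D>(2) I unfolding cd(1)[symmetric] cbox_interval by blast
      ultimately show ?thesis using cd(1) by (auto simp: cInf_atLeastAtMost cSup_atLeastAtMost)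
    qed
    have fin_bound: "measure K (\<Union>\<F>) < \<epsilon>" if \<F>: "finite \<F>" "\<F> \<subseteq> \<D>" for \<F>
    proof -
      define e where "e I = (Inf I, Sup I)" for I :: "real set"
      have inj: "inj_on e \<F>"
        by (rule inj_onI) (metis Pair_inject ends e_def subsetD \<F>(2))
      have int_I: "interior I = {Inf I<..<Sup I}" if "I \<in> \<F>" for I
        using ends[of I] that \<F>(2) by (metis interior_atLeastAtMost_real subsetD)
      have disj: "pairwise (\<lambda>p q. disjnt {fst p<..<snd p} {fst q<..<snd q}) (e ` \<F>)"
      proof (rule pairwise_imageI)
        fix I J assume IJ: "I \<in> \<F>" "J \<in> \<F>" "I \<noteq> J"
        then have "interior I \<inter> interior J = {}"
          using \<D>(4) \<F>(2) unfolding pairwise_def by blast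
        then show "disjnt {fst (e I)<..<snd (e I)} {fst (e J)<..<snd (e J)}"
          using int_I IJ by (simp add: disjnt_def e_def)
      qed
      have reindex: "(\<Sum>(u, v)\<in>e ` \<F>. f u v) = (\<Sum>I\<in>\<F>. f (Inf I) (Sup I))"
        for f :: "real \<Rightarrow> real \<Rightarrow> real"
        by (subst sum.reindex[OF inj]) (simp add: e_def)
      have "(\<Sum>(u, v)\<in>e ` \<F>. v - u) = (\<Sum>I\<in>\<F>. Sup I - Inf I)"
        by (rule reindex)
      also have "\<dots> = (\<Sum>I\<in>\<F>. measure lebesgue I)"
      proof (rule sum.cong[OF refl])
        fix I assume "I \<in> \<F>"
        then have "I = {Inf I..Sup I}" "Inf I < Sup I" using ends \<F>(2) by auto
        then show "Sup I - Inf I = measure lebesgue I"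
          by (metis less_imp_le measure_lborel_Icc measure_completion sets_lborel atLeastAtMost_borel)
      qed
      also have "\<dots> = measure lebesgue (\<Union>\<F>)"
      proof (rule measure_negligible_finite_Union[symmetric])
        show "finite \<F>" by fact
        show "S \<in> lmeasurable" if "S \<in> \<F>" for S
          using \<D>(3)[of S] that \<F>(2) by auto
        show "pairwise (\<lambda>S T. negligible (S \<inter> T)) \<F>"
        proof (rule pairwiseI)
          fix S T assume "S \<in> \<F>" "T \<in> \<F>" "S \<noteq> T"
          then have ST: "S \<in> \<D>" "T \<in> \<D>" "interior S \<inter> interior T = {}"
            using \<D>(4) \<F>(2) by (auto simp: pairwise_def)
          obtain c d c' d' where "S = cbox c d" "T = cbox c' d'" using \<D>(3) ST by metis
          then have "convex (S \<inter> T)" by (simp add: convex_Int)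
          moreover have "interior (S \<inter> T) = {}" using ST by (simp add: interior_Int)
          ultimately show "negligible (S \<inter> T)"
            using negligible_convex_interior by blast
        qed
      qed
      also have "\<dots> < \<delta>"
      proof -
        have "\<Union>\<F> \<in> sets borel"
        proof (intro sets.finite_Union subsetI)
          fix I assume "I \<in> \<F>"
          then obtain c d where "I = cbox c d" using \<D>(3) \<F>(2) by blast
          then show "I \<in> sets borel" by simp
        qed (rule \<F>)
        moreover have "\<Union>\<F> \<subseteq> U" using \<F>(2) \<D>U by auto
        ultimately have "emeasure lborel (\<Union>\<F>) < \<delta>"
          using U_small emeasure_mono[of "\<Union>\<F>" U lborel] U(1) by (simp add: order_le_less_trans)
        moreover from this have "emeasure lborel (\<Union>\<F>) = ennreal (measure lborel (\<Union>\<F>))"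
          by (intro emeasure_eq_ennreal_measure) auto
        ultimately have "measure lborel (\<Union>\<F>) < \<delta>"
          using \<open>\<delta> > 0\<close> by (simp add: ennreal_less_iff)
        then show ?thesis
          using \<open>\<Union>\<F> \<in> sets borel\<close> by simp
      qed
      finally have "(\<Sum>(u, v)\<in>e ` \<F>. \<bar>F v - F u\<bar>) < \<epsilon>"
        using disj \<F> ends
        by (intro \<delta>[rule_format, of "e ` \<F>"]) (auto simp: e_def)
      then have sum_lt: "(\<Sum>I\<in>\<F>. \<bar>F (Sup I) - F (Inf I)\<bar>) < \<epsilon>"
        using reindex[of "\<lambda>u v. \<bar>F v - F u\<bar>"] by simp
      have "measure K (\<Union>\<F>) \<le> (\<Sum>I\<in>\<F>. measure K I)"
      proof -
        have "I \<in> sets K" if "I \<in> \<F>" for I using that ends[of I] \<F>(2) sets_K by (metis atLeastAtMost_borel subsetD)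
        then show ?thesis using \<F>(1) measure_UNION_le[of \<F> "\<lambda>x. x" K] by simp
      qed
      also have "\<dots> \<le> (\<Sum>I\<in>\<F>. \<bar>F (Sup I) - F (Inf I)\<bar>)"
      proof (rule sum_mono)
        fix I assume "I \<in> \<F>"
        then have "I = {Inf I..Sup I} \<and> a \<le> Inf I \<and> Inf I < Sup I \<and> Sup I \<le> b" using ends \<F>(2) by blast
        then show "measure K I \<le> \<bar>F (Sup I) - F (Inf I)\<bar>" using K[of "Inf I" "Sup I"] by simp
      qed
      finally show ?thesis using sum_lt by simp
    qed
    have Dm: "I \<in> sets K" if "I \<in> \<D>" for I
      using ends[OF that] sets_K by (metis atLeastAtMost_borel)
    show ?thesis
    proof (cases "\<D> = {}")
      case True
      then show ?thesis using \<D>(6) \<open>\<epsilon> > 0\<close> by auto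
    next
      case False
      define X where "X n = \<Union>(from_nat_into \<D> ` {..n})" for n :: nat
      have "(\<Union>n. X n) = \<Union>\<D>"
      proof -
        have "(\<Union>n. X n) = \<Union>(range (from_nat_into \<D>))" unfolding X_def by blast
        then show ?thesis using range_from_nat_into[OF False \<D>(1)] by simp
      qed
      moreover have Xm: "range X \<subseteq> sets K"
        using False Dm unfolding X_def by (auto intro!: sets.finite_Union from_nat_into)
      moreover have "incseq X" unfolding X_def incseq_def by force
      ultimately have "(\<lambda>n. measure K (X n)) \<longlonglongrightarrow> measure K (\<Union>\<D>)"
        using finite_Lim_measure_incseq[of X] by simp
      moreover have "measure K (X n) \<le> \<epsilon>" for n
      proof -
        have "measure K (X n) < \<epsilon>"
          unfolding X_def by (rule fin_bound) (use from_nat_into[OF False] in auto)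
        then show ?thesis by simp
      qed
      ultimately have "measure K (\<Union>\<D>) \<le> \<epsilon>" by (intro LIMSEQ_le_const2[of "\<lambda>n. measure K (X n)"]) auto
      moreover have "measure K (N \<inter> {a..b}) \<le> measure K (\<Union>\<D>)"
        using \<D>(1,6) Dm by (intro finite_measure_mono sets.countable_Union) auto
      ultimately show ?thesis by simp
    qed
  qed
  have "measure K (N \<inter> {a..b}) \<le> 0"
    by (rule field_le_epsilon) (use small in auto)
  then show ?thesis by (simp add: emeasure_eq_measure order.antisym)
qed

text \<open>
  The density is the Radon--Nikodym derivative; that it is also the pointwise derivative of the
  distribution function is Lebesgue's differentiation theorem. The one-sided version of that
  theorem for boxes \<open>[x, x + h]\<close> gives the right derivative, and its application to the reflected
  density gives the left derivative.
\<close>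

lemma cdf_has_density_derivative:
  fixes K :: "real measure"
  assumes fin: "finite_measure K" and sets_K: "sets K = sets borel"
    and ac: "absolutely_continuous lborel K"
  obtains d where "d \<in> borel_measurable borel" "\<And>x. 0 \<le> d x"
    "K = density lborel (\<lambda>x. ennreal (d x))"
    "AE x in lborel. ((\<lambda>x. measure K {..x}) has_real_derivative d x) (at x)"
proof -
  interpret finite_measure K by (rule fin)
  define d where "d x = enn2real (RN_deriv lborel K x)" for x
  have dm: "d \<in> borel_measurable lborel" and d_nn: "\<And>x. 0 \<le> d x"
    unfolding d_def by auto
  have "AE x in lborel. RN_deriv lborel K x \<noteq> \<infinity>"
    using ac sets_K by (intro sigma_finite_measure.RN_deriv_finite[OF lborel.sigma_finite_measure_axioms]) (auto intro: sigma_finite_measure_axioms)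
  then have d_RN: "AE x in lborel. RN_deriv lborel K x = ennreal (d x)"
    by eventually_elim (auto simp: d_def less_top)
  have Kd: "K = density lborel (\<lambda>x. ennreal (d x))"
  proof -
    have "density lborel (RN_deriv lborel K) = K"
      using ac sets_K by (intro sigma_finite_measure.density_RN_deriv[OF lborel.sigma_finite_measure_axioms]) auto
    moreover have "density lborel (RN_deriv lborel K) = density lborel (\<lambda>x. ennreal (d x))"
      using dm d_RN by (intro density_cong) auto
    ultimately show ?thesis by simp
  qed
  have dm'[measurable]: "d \<in> borel_measurable borel" using dm by simp
  have "emeasure K UNIV = (\<integral>\<^sup>+x. ennreal (d x) \<partial>lborel)"
    by (subst Kd, subst emeasure_density) auto
  then have int_d: "integrable lborel d"
    using d_nn emeasure_finite[of UNIV] by (intro integrableI_nonneg) (auto simp: less_top)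
  have K_Icc: "measure K {u..v} = integral {u..v} d" for u v
  proof -
    have si: "set_integrable lborel {u..v} d"
      using integrable_mult_indicator[OF _ int_d, of "{u..v}"] by (simp add: set_integrable_def)
    have "emeasure K {u..v} = (\<integral>\<^sup>+x. ennreal (indicator {u..v} x * d x) \<partial>lborel)"
      by (subst Kd, subst emeasure_density) (auto intro!: nn_integral_cong split: split_indicator)
    also have "\<dots> = ennreal (\<integral>x. indicator {u..v} x * d x \<partial>lborel)"
      using si d_nn by (intro nn_integral_eq_integral) (auto simp: set_integrable_def)
    also have "(\<integral>x. indicator {u..v} x * d x \<partial>lborel) = integral {u..v} d"
      using set_borel_integral_eq_integral(2)[OF si] by (simp add: set_lebesgue_integral_def)
    finally show ?thesis
      using d_nn by (simp add: measure_def integral_nonneg[OF set_borel_integral_eq_integral(1)[OF si]])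
  qed
  have K_diff: "measure K {..v} - measure K {..u} = integral {u..v} d" if "u \<le> v" for u v
  proof -
    have "measure K {..v} = measure K ({..<u} \<union> {u..v})"
      using that by (intro arg_cong[where f="measure K"]) auto
    also have "\<dots> = measure K {..<u} + measure K {u..v}"
      by (rule finite_measure_Union) (auto simp: sets_K)
    also have "measure K {..<u} = measure K {..u}"
    proof -
      have "measure K {..u} = measure K ({..<u} \<union> {u..u})"
        by (intro arg_cong[where f="measure K"]) auto
      also have "\<dots> = measure K {..<u} + measure K {u..u}"
        by (rule finite_measure_Union) (auto simp: sets_K)
      finally show ?thesis using K_Icc[of u u] by simp
    qed
    finally show ?thesis by (simp add: K_Icc)
  qed
  have d_on: "d integrable_on cbox u v" for u v
    using integrable_mult_indicator[OF _ int_d, of "cbox u v"]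
    by (intro set_borel_integral_eq_integral(1)) (simp add: set_integrable_def)
  then have d_on': "(\<lambda>x. d (- x)) integrable_on cbox u v" for u v
    using integrable_reflect[where a="-v" and b="-u" and f=d] by (metis minus_minus)
  obtain N1 where N1: "negligible N1" "\<And>x e. x \<notin> N1 \<Longrightarrow> 0 < e \<Longrightarrow>
      \<exists>\<delta>>0. \<forall>h. 0 < h \<and> h < \<delta> \<longrightarrow> \<bar>integral {x..x + h} d / h - d x\<bar> < e"
    using integrable_ccontinuous_explicit[OF d_on] by (auto simp: cbox_interval divide_inverse_commute)
  obtain N2 where N2: "negligible N2" "\<And>x e. x \<notin> N2 \<Longrightarrow> 0 < e \<Longrightarrow>
      \<exists>\<delta>>0. \<forall>h. 0 < h \<and> h < \<delta> \<longrightarrow> \<bar>integral {x..x + h} (\<lambda>x. d (- x)) / h - d (- x)\<bar> < e"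
    using integrable_ccontinuous_explicit[OF d_on'] by (auto simp: cbox_interval divide_inverse_commute)
  have "negligible (uminus ` N2)"
  proof (intro negligible_locally_Lipschitz_image)
    show "\<exists>T B. open T \<and> x \<in> T \<and> (\<forall>y\<in>N2 \<inter> T. norm (- y - - x) \<le> B * norm (y - x))" for x
      by (intro exI[of _ UNIV] exI[of _ 1]) (auto simp: abs_minus_commute)
  qed (use N2 in auto)
  then have "negligible (N1 \<union> uminus ` N2)" using N1(1) by auto
  then have "AE x in lebesgue. x \<notin> N1 \<union> uminus ` N2"
    unfolding negligible_iff_null_sets by (rule AE_not_in)
  then have AE1: "AE x in lborel. x \<notin> N1 \<union> uminus ` N2"
    by (simp add: AE_completion_iff)
  have "AE x in lborel. ((\<lambda>x. measure K {..x}) has_real_derivative d x) (at x)"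
    using AE1
  proof eventually_elim
    case (elim x)
    then have "x \<notin> N1" "- x \<notin> N2" by (auto simp: image_iff)
    show ?case unfolding DERIV_def
    proof (rule LIM_I)
      fix e :: real assume "0 < e"
      obtain \<delta>1 where d1: "\<delta>1 > 0" "\<And>h. 0 < h \<Longrightarrow> h < \<delta>1 \<Longrightarrow> \<bar>integral {x..x + h} d / h - d x\<bar> < e"
        using N1(2)[OF \<open>x \<notin> N1\<close> \<open>0 < e\<close>] by auto
      obtain \<delta>2 where d2: "\<delta>2 > 0" "\<And>h. 0 < h \<Longrightarrow> h < \<delta>2 \<Longrightarrow> \<bar>integral {-x..-x + h} (\<lambda>x. d (- x)) / h - d x\<bar> < e"
        using N2(2)[OF \<open>-x \<notin> N2\<close> \<open>0 < e\<close>] by auto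
      show "\<exists>r>0. \<forall>h. h \<noteq> 0 \<and> norm (h - 0) < r \<longrightarrow>
          norm ((measure K {..x + h} - measure K {..x}) / h - d x) < e"
      proof (intro exI[of _ "min \<delta>1 \<delta>2"] conjI allI impI)
        show "0 < min \<delta>1 \<delta>2" using d1 d2 by simp
        fix h :: real assume h: "h \<noteq> 0 \<and> norm (h - 0) < min \<delta>1 \<delta>2"
        show "norm ((measure K {..x + h} - measure K {..x}) / h - d x) < e"
        proof (cases "0 < h")
          case True
          then show ?thesis using d1(2)[of h] h K_diff[of x "x + h"] by simp
        next
          case False
          \<comment> \<open>for \<open>h < 0\<close> the quotient is the average of the reflected density to the right of \<open>-x\<close>\<close>
          have "integral {- x..- (x + h)} (\<lambda>x. d (- x)) = integral {x + h..x} d"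
            using integral_reflect[where a="x + h" and b=x and f=d] by (simp only: cbox_interval)
          moreover have "measure K {..x} - measure K {..x + h} = integral {x + h..x} d"
            using False by (intro K_diff) simp
          ultimately have "(measure K {..x + h} - measure K {..x}) / h = integral {-x..-x + (-h)} (\<lambda>x. d (- x)) / (-h)"
            using h by (simp add: field_simps)
          then show ?thesis using d2(2)[of "-h"] h False by simp
        qed
      qed
    qed
  qed
  with dm' d_nn Kd show ?thesis using that by blast
qed

lemma abs_cont_on_dominated:
  assumes f: "abs_cont_on a b f"
    and g: "\<And>u v. a \<le> u \<Longrightarrow> u \<le> v \<Longrightarrow> v \<le> b \<Longrightarrow> \<bar>g v - g u\<bar> \<le> L * \<bar>f v - f u\<bar>"
  shows "abs_cont_on a b g"
  unfolding abs_cont_on_def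
proof (intro allI impI)
  fix \<epsilon> :: real assume "\<epsilon> > 0"
  define C where "C = max L 1"
  have "C > 0" "L \<le> C" by (auto simp: C_def)
  then have "\<epsilon> / C > 0" using \<open>\<epsilon> > 0\<close> by simp
  from f[unfolded abs_cont_on_def, rule_format, OF this]
  obtain \<delta> where "\<delta> > 0" and \<delta>: "\<forall>P :: (real \<times> real) set.
        finite P \<and> (\<forall>(u, v)\<in>P. a \<le> u \<and> u < v \<and> v \<le> b) \<and>
        pairwise (\<lambda>p q. disjnt {fst p<..<snd p} {fst q<..<snd q}) P \<and>
        (\<Sum>(u, v)\<in>P. v - u) < \<delta> \<longrightarrow> (\<Sum>(u, v)\<in>P. \<bar>f v - f u\<bar>) < \<epsilon> / C"
    by (elim exE conjE) (rule that)
  show "\<exists>\<delta>>0. \<forall>P. finite P \<and> (\<forall>(u, v)\<in>P. a \<le> u \<and> u < v \<and> v \<le> b) \<and>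
        pairwise (\<lambda>p q. disjnt {fst p<..<snd p} {fst q<..<snd q}) P \<and>
        (\<Sum>(u, v)\<in>P. v - u) < \<delta> \<longrightarrow> (\<Sum>(u, v)\<in>P. \<bar>g v - g u\<bar>) < \<epsilon>"
  proof (intro exI[of _ \<delta>] conjI allI impI)
    show "\<delta> > 0" by fact
    fix P :: "(real \<times> real) set"
    assume P: "finite P \<and> (\<forall>(u, v)\<in>P. a \<le> u \<and> u < v \<and> v \<le> b) \<and>
        pairwise (\<lambda>p q. disjnt {fst p<..<snd p} {fst q<..<snd q}) P \<and> (\<Sum>(u, v)\<in>P. v - u) < \<delta>"
    have "(\<Sum>(u, v)\<in>P. \<bar>g v - g u\<bar>) \<le> (\<Sum>(u, v)\<in>P. C * \<bar>f v - f u\<bar>)"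
    proof (rule sum_mono, clarify)
      fix u v assume "(u, v) \<in> P"
      then have "\<bar>g v - g u\<bar> \<le> L * \<bar>f v - f u\<bar>" using P by (intro g) auto
      also have "\<dots> \<le> C * \<bar>f v - f u\<bar>" using \<open>L \<le> C\<close> by (intro mult_right_mono) auto
      finally show "\<bar>g v - g u\<bar> \<le> C * \<bar>f v - f u\<bar>" .
    qed
    also have "\<dots> = C * (\<Sum>(u, v)\<in>P. \<bar>f v - f u\<bar>)"
      by (simp add: sum_distrib_left case_prod_unfold)
    also have "\<dots> < C * (\<epsilon> / C)"
      using \<delta>[rule_format, OF P] \<open>C > 0\<close> by (intro mult_strict_left_mono)
    finally show "(\<Sum>(u, v)\<in>P. \<bar>g v - g u\<bar>) < \<epsilon>" using \<open>C > 0\<close> by simp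
  qed
qed

text \<open>
  Absolute continuity for a family consisting of a single interval.
\<close>

lemma locally_abs_cont_imp_continuous_on:
  assumes "locally_abs_cont f"
  shows "continuous_on {0..} f"
  unfolding continuous_on_iff
proof (intro ballI allI impI)
  fix x \<epsilon> :: real assume x: "x \<in> {0..}" and "0 < \<epsilon>"
  then have "abs_cont_on 0 (x + 1) f" using assms by (auto simp: locally_abs_cont_def)
  from this[unfolded abs_cont_on_def, rule_format, OF \<open>0 < \<epsilon>\<close>]
  obtain \<delta> where "\<delta> > 0" and \<delta>: "\<forall>P :: (real \<times> real) set.
        finite P \<and> (\<forall>(u, v)\<in>P. 0 \<le> u \<and> u < v \<and> v \<le> x + 1) \<and>
        pairwise (\<lambda>p q. disjnt {fst p<..<snd p} {fst q<..<snd q}) P \<and>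
        (\<Sum>(u, v)\<in>P. v - u) < \<delta> \<longrightarrow> (\<Sum>(u, v)\<in>P. \<bar>f v - f u\<bar>) < \<epsilon>"
    by (elim exE conjE) (rule that)
  have close: "\<bar>f v - f u\<bar> < \<epsilon>" if "0 \<le> u" "u < v" "v \<le> x + 1" "v - u < \<delta>" for u v
    using \<delta>[rule_format, of "{(u, v)}"] that by simp
  show "\<exists>d>0. \<forall>x'\<in>{0..}. dist x' x < d \<longrightarrow> dist (f x') (f x) < \<epsilon>"
  proof (intro exI[of _ "min \<delta> 1"] conjI ballI impI)
    show "0 < min \<delta> 1" using \<open>\<delta> > 0\<close> by simp
    fix y assume y: "y \<in> {0..}" "dist y x < min \<delta> 1"
    consider "y < x" | "y = x" | "x < y" by linarith
    then show "dist (f y) (f x) < \<epsilon>"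
    proof cases
      case 1 then show ?thesis using close[of y x] y by (auto simp: dist_real_def)
    next
      case 2 then show ?thesis using \<open>0 < \<epsilon>\<close> by simp
    next
      case 3 then show ?thesis using close[of x y] x y by (auto simp: dist_real_def)
    qed
  qed
qed

section \<open>The averaging operator as an expectation\<close>

lemma clamp_measurable:
  assumes "continuous_on {0..} (h :: real \<Rightarrow> real)"
  shows "(\<lambda>v. h (max 0 v)) \<in> borel_measurable borel"
  by (intro borel_measurable_continuous_onI continuous_on_compose2[OF assms] continuous_intros) auto

locale scale_function =
  fixes \<theta> :: real and s :: "real \<Rightarrow> real"
  assumes theta_pos: "0 < \<theta>"
    and s_ac: "locally_abs_cont s"
    and s_mono: "strict_mono_on {0..} s"
    and s_0: "s 0 = 0"
begin

definition t :: "real \<Rightarrow> real" where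
  "t x = s x powr \<theta>"

text \<open>
  For \<open>u\<close> in the unit interval this is also \<open>t\<inverse>(u t(x))\<close>: the quantile function of the law on
  \<open>[0, x]\<close> with distribution function \<open>t / t(x)\<close>.
\<close>

definition quantile :: "real \<Rightarrow> real \<Rightarrow> real" where
  "quantile x u = inv_into {0..} s (u powr (1 / \<theta>) * s x)"

abbreviation unif :: "real measure" where
  "unif \<equiv> uniform_measure lborel {0..1}"

definition kernel :: "real \<Rightarrow> real measure" where
  "kernel x = distr unif borel (quantile x)"

lemma s_cont: "continuous_on {0..} s"
  using s_ac by (rule locally_abs_cont_imp_continuous_on)

lemma s_le_iff: "0 \<le> x \<Longrightarrow> 0 \<le> y \<Longrightarrow> s x \<le> s y \<longleftrightarrow> x \<le> y"
  using strict_mono_on_leD[OF s_mono, of x y] strict_mono_onD[OF s_mono, of y x] by force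

lemma s_nonneg: "0 \<le> x \<Longrightarrow> 0 \<le> s x"
  using s_le_iff[of 0 x] by (simp add: s_0)

lemma s_inj: "inj_on s {0..}"
  using s_mono by (rule strict_mono_on_imp_inj_on)

lemma s_pos: "0 < x \<Longrightarrow> 0 < s x"
  using s_le_iff[of x 0] by (simp add: s_0)

lemma t_0: "t 0 = 0"
  by (simp add: t_def s_0)

lemma t_nonneg: "0 \<le> t x"
  by (simp add: t_def)

lemma t_pos: "0 < x \<Longrightarrow> 0 < t x"
  using s_pos[of x] by (simp add: t_def)

lemma t_le_iff:
  assumes "0 \<le> x" "0 \<le> y"
  shows "t x \<le> t y \<longleftrightarrow> x \<le> y"
proof -
  have "t x \<le> t y \<longleftrightarrow> s x \<le> s y"
    unfolding t_def using s_nonneg assms theta_pos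
    by (metis powr_less_mono2 powr_mono2 linorder_not_less less_imp_le)
  then show ?thesis using assms by (simp add: s_le_iff)
qed

lemma t_cont: "continuous_on {0..} t"
  unfolding t_def using theta_pos s_nonneg s_cont by (intro continuous_on_powr') auto

text \<open>
  The power \<open>z\<^sup>\<theta>\<close> is Lipschitz only away from the origin when \<open>\<theta> < 1\<close>, whence the
  positive left end point; the origin carries no mass and is treated separately in
  \<open>kernel_absolutely_continuous\<close>.
\<close>

lemma t_abs_cont:
  assumes "0 < a" "a \<le> b"
  shows "abs_cont_on a b t"
proof -
  define D where "D z = \<theta> * z powr (\<theta> - 1)" for z
  have pos: "0 < s a" using assms by (simp add: s_pos)
  have "continuous_on {s a..s b} D"
    unfolding D_def using pos by (intro continuous_intros) auto
  then have "bounded (D ` {s a..s b})"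
    by (intro compact_imp_bounded compact_continuous_image) auto
  then obtain C where C: "\<forall>z\<in>{s a..s b}. \<bar>D z\<bar> \<le> C"
    by (auto simp: bounded_iff)
  have bound: "\<bar>p powr \<theta> - q powr \<theta>\<bar> \<le> C * \<bar>p - q\<bar>" if "p \<in> {s a..s b}" "q \<in> {s a..s b}" for p q
  proof -
    have "norm (p powr \<theta> - q powr \<theta>) \<le> C * norm (p - q)"
    proof (rule field_differentiable_bound[of "{s a..s b}" "\<lambda>z. z powr \<theta>" D])
      show "((\<lambda>z. z powr \<theta>) has_field_derivative D z) (at z within {s a..s b})" if "z \<in> {s a..s b}" for z
        using that pos unfolding D_def by (auto intro!: derivative_eq_intros)
      show "norm (D z) \<le> C" if "z \<in> {s a..s b}" for z
        using C that by simp
    qed (use that in auto)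
    then show ?thesis by simp
  qed
  have "abs_cont_on a b s" using s_ac assms by (auto simp: locally_abs_cont_def)
  then show ?thesis
  proof (rule abs_cont_on_dominated)
    show "\<bar>t v - t u\<bar> \<le> C * \<bar>s v - s u\<bar>" if "a \<le> u" "u \<le> v" "v \<le> b" for u v
      unfolding t_def using that assms by (intro bound) (auto simp: s_le_iff)
  qed
qed

lemma s_ivt:
  assumes "0 \<le> x" "0 \<le> y" "y \<le> s x"
  obtains w where "0 \<le> w" "w \<le> x" "s w = y"
proof -
  have "continuous_on {0..x} s"
    by (rule continuous_on_subset[OF s_cont]) auto
  then show ?thesis using IVT'[of s 0 y x] assms s_0 that by auto
qed

lemma quantile_spec:
  assumes "0 \<le> x" "0 \<le> u" "u \<le> 1"
  shows "0 \<le> quantile x u" "quantile x u \<le> x" "t (quantile x u) = u * t x"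
proof -
  define y where "y = u powr (1 / \<theta>) * s x"
  have "u powr (1 / \<theta>) \<le> 1 powr (1 / \<theta>)"
    using assms theta_pos by (intro powr_mono2) auto
  then have "y \<le> s x" unfolding y_def using s_nonneg[OF \<open>0 \<le> x\<close>] by (simp add: mult_left_le_one_le)
  moreover have "0 \<le> y" unfolding y_def using s_nonneg[OF \<open>0 \<le> x\<close>] by simp
  ultimately obtain w where w: "0 \<le> w" "w \<le> x" "s w = y" using s_ivt \<open>0 \<le> x\<close> by metis
  have "quantile x u = w"
    unfolding quantile_def y_def[symmetric] w(3)[symmetric] using s_inj w(1) by (simp add: inv_into_f_f)
  moreover have "y powr \<theta> = u * t x"
    unfolding y_def t_def using assms s_nonneg theta_pos by (simp add: powr_mult powr_powr)
  ultimately show "0 \<le> quantile x u" "quantile x u \<le> x" "t (quantile x u) = u * t x"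
    using w by (auto simp: t_def)
qed

text \<open>
  The inverse is monotone on the range of \<open>s\<close>, an interval, and constant off it because the
  choice operator is then applied to an unsatisfiable predicate.
\<close>

lemma inv_into_measurable [measurable]: "inv_into {0..} s \<in> borel_measurable borel"
proof -
  define R where "R = s ` {0..}"
  have "R = (\<Union>n::nat. {0..s (real n)})"
  proof (intro subset_antisym subsetI)
    fix y assume "y \<in> R"
    then obtain x where x: "0 \<le> x" "y = s x" by (auto simp: R_def)
    obtain n :: nat where "x \<le> real n" using real_arch_simple by blast
    then show "y \<in> (\<Union>n::nat. {0..s (real n)})"
      using x s_le_iff[of x "real n"] s_nonneg[of x] by auto
  next
    fix y assume "y \<in> (\<Union>n::nat. {0..s (real n)})"
    then show "y \<in> R" unfolding R_def using s_ivt by (metis (no_types) UN_E atLeastAtMost_iff atLeast_iff imageI of_nat_0_le_iff)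
  qed
  then have R_borel: "R \<in> sets borel" by simp
  have "mono_on R (inv_into {0..} s)"
  proof (rule mono_onI)
    fix y z assume yz: "y \<in> R" "z \<in> R" "y \<le> z"
    then have "s (inv_into {0..} s y) \<le> s (inv_into {0..} s z)"
      by (simp add: R_def f_inv_into_f)
    moreover have "0 \<le> inv_into {0..} s y" "0 \<le> inv_into {0..} s z"
      using yz inv_into_into[of _ s "{0..}"] by (auto simp: R_def)
    ultimately show "inv_into {0..} s y \<le> inv_into {0..} s z" by (simp add: s_le_iff)
  qed
  then have "inv_into {0..} s \<in> borel_measurable (restrict_space borel R)"
    by (rule borel_measurable_mono_on_fnc)
  then have "(\<lambda>y. if y \<in> R then inv_into {0..} s y else (SOME x. False)) \<in> borel_measurable borel"
    using R_borel by (subst measurable_If_restrict_space_iff) auto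
  also have "(\<lambda>y. if y \<in> R then inv_into {0..} s y else (SOME x. False)) = inv_into {0..} s"
  proof
    fix y
    have "inv_into {0..} s y = (SOME x. False)" if "y \<notin> R"
      using that unfolding inv_into_def R_def by (intro arg_cong[where f=Eps]) auto
    then show "(if y \<in> R then inv_into {0..} s y else (SOME x. False)) = inv_into {0..} s y" by simp
  qed
  finally show ?thesis .
qed

lemma quantile_measurable [measurable]: "quantile x \<in> borel_measurable borel"
  unfolding quantile_def by measurable

lemma unif_prob: "prob_space unif"
  by (rule prob_space_uniform_measure) auto

lemma AE_unif: "AE u in unif. 0 \<le> u \<and> u \<le> 1"
  by (rule AE_uniform_measureI) auto

lemma kernel_prob: "prob_space (kernel x)"
  unfolding kernel_def using unif_prob by (rule prob_space.prob_space_distr) simp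

lemma sets_kernel [simp, measurable_cong]: "sets (kernel x) = sets borel"
  by (simp add: kernel_def)

lemma AE_kernel:
  assumes "0 \<le> x"
  shows "AE v in kernel x. 0 \<le> v \<and> v \<le> x"
  unfolding kernel_def
proof (subst AE_distr_iff)
  show "AE u in unif. 0 \<le> quantile x u \<and> quantile x u \<le> x"
    using AE_unif by eventually_elim (use quantile_spec assms in auto)
qed auto

text \<open>
  The preimage of an interval under the quantile function is an interval, because
  \<open>quantile x r \<le> v\<close> exactly when \<open>r \<le> t v / t x\<close>.
\<close>

lemma kernel_Icc:
  assumes "0 < x" "0 \<le> u" "u \<le> v" "v \<le> x"
  shows "measure (kernel x) {u..v} = (t v - t u) / t x"
proof -
  have tx: "0 < t x" using assms t_pos by simp
  have eq: "{0..1} \<inter> quantile x -` {u..v} = {t u / t x..t v / t x}"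
  proof (intro set_eqI)
    fix r
    have "u \<le> quantile x r \<longleftrightarrow> t u / t x \<le> r" "quantile x r \<le> v \<longleftrightarrow> r \<le> t v / t x" if "0 \<le> r" "r \<le> 1"
      using quantile_spec[of x r] that assms tx t_le_iff[of u "quantile x r"] t_le_iff[of "quantile x r" v]
      by (auto simp: field_simps)
    moreover have "0 \<le> t u / t x" "t v / t x \<le> 1"
      using tx t_nonneg t_le_iff[of v x] assms by auto
    ultimately show "r \<in> {0..1} \<inter> quantile x -` {u..v} \<longleftrightarrow> r \<in> {t u / t x..t v / t x}"
      by force
  qed
  have "measure (kernel x) {u..v} = measure unif (quantile x -` {u..v})"
    unfolding kernel_def by (subst measure_distr) auto
  also have "\<dots> = measure lborel ({0..1} \<inter> quantile x -` {u..v}) / measure lborel {0..1::real}"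
    by (rule measure_uniform_measure) (auto intro!: measurable_sets_borel[OF quantile_measurable])
  also have "\<dots> = (t v - t u) / t x"
  proof -
    have "t u / t x \<le> t v / t x" using assms tx t_le_iff[of u v] by (simp add: divide_right_mono)
    then show ?thesis unfolding eq by (simp add: diff_divide_distrib)
  qed
  finally show ?thesis .
qed

lemma kernel_atMost:
  assumes "0 < x" "0 \<le> y" "y \<le> x"
  shows "measure (kernel x) {..y} = t y / t x"
proof -
  interpret prob_space "kernel x" by (rule kernel_prob)
  have "measure (kernel x) {..y} = measure (kernel x) {0..y}"
    using AE_kernel[of x] assms by (intro finite_measure_eq_AE) auto
  then show ?thesis using kernel_Icc[of x 0 y] assms by (simp add: t_0)
qed

text \<open>
  Away from the origin \<open>abs_cont_null\<close> applies, and the origin is not an atom.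
\<close>

lemma kernel_absolutely_continuous:
  assumes x: "0 < x"
  shows "absolutely_continuous lborel (kernel x)"
  unfolding absolutely_continuous_def
proof
  fix N :: "real set" assume N: "N \<in> null_sets lborel"
  then have Nm[measurable]: "N \<in> sets borel" by auto
  interpret prob_space "kernel x" by (rule kernel_prob)
  have tx: "0 < t x" using x t_pos by simp
  \<comment> \<open>left end points in \<open>(0, x)\<close> that tend to the origin\<close>
  define \<epsilon> where "\<epsilon> n = x / (real n + 2)" for n :: nat
  have \<epsilon>: "0 < \<epsilon> n" "\<epsilon> n < x" for n unfolding \<epsilon>_def using x by (auto simp: field_simps add_pos_nonneg)
  have null: "emeasure (kernel x) (N \<inter> {\<epsilon> n..x}) = 0" for n
  proof (rule abs_cont_null[OF _ _ _ \<epsilon>(2) _ N])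
    show "finite_measure (kernel x)" by (rule finite_measure_axioms)
    show "sets (kernel x) = sets borel" by simp
    have "abs_cont_on (\<epsilon> n) x t" using \<epsilon>[of n] by (intro t_abs_cont) auto
    then show "abs_cont_on (\<epsilon> n) x (\<lambda>y. t y / t x)"
      by (rule abs_cont_on_dominated[where L="1 / t x"]) (use tx in \<open>simp add: diff_divide_distrib[symmetric]\<close>)
    show "measure (kernel x) {u..v} = t v / t x - t u / t x" if "\<epsilon> n \<le> u" "u \<le> v" "v \<le> x" for u v
      using kernel_Icc[of x u v] x \<epsilon>(1)[of n] that by (simp add: diff_divide_distrib)
  qed
  have "emeasure (kernel x) (\<Union>n. N \<inter> {\<epsilon> n..x}) = 0"
    using null by (intro emeasure_UN_eq_0) auto
  moreover have "emeasure (kernel x) {0} = 0"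
    using kernel_Icc[of x 0 0] x by (simp add: emeasure_eq_measure)
  ultimately have "emeasure (kernel x) ((\<Union>n. N \<inter> {\<epsilon> n..x}) \<union> {0}) = 0"
    by (subst emeasure_Un_null_set) (auto simp: null_sets_def)
  moreover have "emeasure (kernel x) N \<le> emeasure (kernel x) ((\<Union>n. N \<inter> {\<epsilon> n..x}) \<union> {0})"
  proof (rule emeasure_mono_AE)
    have "\<exists>n. \<epsilon> n \<le> v" if "0 < v" for v
    proof -
      obtain n :: nat where "x / v < real n" using reals_Archimedean2 by blast
      then have "\<epsilon> n \<le> v" using that x unfolding \<epsilon>_def by (simp add: field_simps add_pos_pos)
      then show ?thesis ..
    qed
    note * = this
    show "AE v in kernel x. v \<in> N \<longrightarrow> v \<in> (\<Union>n. N \<inter> {\<epsilon> n..x}) \<union> {0}"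
      using AE_kernel[OF less_imp_le[OF x]]
    proof eventually_elim
      case (elim v)
      then show ?case using *[of v] by (cases "v = 0") auto
    qed
  qed simp
  ultimately show "N \<in> null_sets (kernel x)" by (simp add: null_sets_def)
qed

text \<open>
  This is the fundamental theorem of calculus for \<open>t\<close> on \<open>(0, x)\<close>: the law \<open>kernel x\<close> has
  distribution function \<open>t / t(x)\<close> there and is absolutely continuous, so its density is
  \<open>t' / t(x)\<close>. At almost every point \<open>t\<close> is differentiable, so \<open>deriv t\<close> is the actual derivative
  there and not a default value.
\<close>

lemma kernel_density:
  assumes x: "0 < x"
  obtains d where "d \<in> borel_measurable borel" "\<And>y. 0 \<le> d y"
    "kernel x = density lborel (\<lambda>y. ennreal (d y))"
    "AE y in lborel. 0 < y \<and> y < x \<longrightarrow> deriv t y = t x * d y"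
proof -
  interpret prob_space "kernel x" by (rule kernel_prob)
  obtain d where d: "d \<in> borel_measurable borel" "\<And>y. 0 \<le> d y"
    "kernel x = density lborel (\<lambda>y. ennreal (d y))"
    "AE y in lborel. ((\<lambda>y. measure (kernel x) {..y}) has_real_derivative d y) (at y)"
    using cdf_has_density_derivative[OF finite_measure_axioms sets_kernel kernel_absolutely_continuous[OF x]] by blast
  have tx: "0 < t x" using x t_pos by simp
  have "AE y in lborel. 0 < y \<and> y < x \<longrightarrow> deriv t y = t x * d y"
    using d(4)
  proof eventually_elim
    case (elim y)
    show ?case
    proof
      assume y: "0 < y \<and> y < x"
      have "((\<lambda>y. t x * measure (kernel x) {..y}) has_real_derivative t x * d y) (at y)"
        by (rule DERIV_cmult[OF elim])
      then have "(t has_real_derivative t x * d y) (at y)"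
      proof (rule has_field_derivative_transform_within_open[where S="{0<..<x}"])
        show "t x * measure (kernel x) {..z} = t z" if "z \<in> {0<..<x}" for z
          using kernel_atMost[of x z] that tx by simp
      qed (use y in auto)
      then show "deriv t y = t x * d y" by (rule DERIV_imp_deriv)
    qed
  qed
  with d(1-3) show ?thesis using that by blast
qed

text \<open>
  The averaging operator is the expectation under \<open>kernel x\<close>. The argument of \<open>h\<close> is clamped to
  \<open>[0, \<infinity>)\<close>, where the kernel lives, because \<open>h\<close> may fail to be measurable on the negative
  half-line.
\<close>

lemma avg_op_kernel:
  assumes x: "0 < x" and h: "continuous_on {0..} h"
  shows "avg_op t h x = (\<integral>v. h (max 0 v) \<partial>kernel x)"
proof -
  have hm[measurable]: "(\<lambda>v. h (max 0 v)) \<in> borel_measurable borel"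
    by (intro borel_measurable_continuous_onI continuous_on_compose2[OF h] continuous_intros) auto
  obtain d where d[measurable]: "d \<in> borel_measurable borel" and d_nn: "\<And>y. 0 \<le> d y"
    and K: "kernel x = density lborel (\<lambda>y. ennreal (d y))"
    and dd: "AE y in lborel. 0 < y \<and> y < x \<longrightarrow> deriv t y = t x * d y"
    using kernel_density[OF x] by blast
  have "AE v in lborel. 0 < ennreal (d v) \<longrightarrow> 0 \<le> v \<and> v \<le> x"
    using AE_kernel[OF less_imp_le[OF x]] unfolding K by (subst (asm) AE_density) auto
  then have eq: "AE v in lborel. t x * (d v * h (max 0 v)) = indicator {0..x} v *\<^sub>R (h v * deriv t v)"
    using dd AE_lborel_singleton[of 0] AE_lborel_singleton[of x]
  proof eventually_elim
    case (elim v)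
    show ?case
    proof (cases "0 < v \<and> v < x")
      case True
      then show ?thesis using elim by simp
    next
      case False
      then have "v \<notin> {0..x}" using elim by auto
      then have "d v = 0" using elim d_nn[of v] by (auto simp: less_le)
      then show ?thesis using \<open>v \<notin> {0..x}\<close> by simp
    qed
  qed
  have m: "(\<lambda>v. t x * (d v * h (max 0 v))) \<in> borel_measurable lebesgue"
    by (intro measurable_completion) measurable
  have "(LINT v:{0..x}|lebesgue. h v * deriv t v) = (\<integral>v. t x * (d v * h (max 0 v)) \<partial>lebesgue)"
    unfolding set_lebesgue_integral_def
    using m AE_completion[OF eq] borel_measurable_AE[OF m AE_completion[OF eq]]
    by (intro integral_cong_AE) auto
  also have "\<dots> = (\<integral>v. t x * (d v * h (max 0 v)) \<partial>lborel)"
    by (rule integral_completion) measurable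
  also have "\<dots> = t x * (\<integral>v. h (max 0 v) \<partial>kernel x)"
    unfolding K using d_nn by (subst integral_density) auto
  finally show ?thesis using x t_pos[of x] by (simp add: avg_op_def)
qed

section \<open>Coupling the averages\<close>

definition T :: "real \<Rightarrow> real" where
  "T x = integral {0..x} t"

definition kernel_avg :: "(real \<Rightarrow> real) \<Rightarrow> real \<Rightarrow> real" where
  "kernel_avg h x = (\<integral>v. h (max 0 v) \<partial>kernel x)"

lemma t_cont_Icc: "0 \<le> u \<Longrightarrow> continuous_on {u..v} t"
  by (rule continuous_on_subset[OF t_cont]) auto

lemma t_integrable: "0 \<le> u \<Longrightarrow> t integrable_on {u..v}"
  using t_cont_Icc by (rule integrable_continuous_real)

lemma set_lebesgue_integral_t: "(LINT u:{0..x}|lebesgue. t u) = T x"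
  unfolding T_def using absolutely_integrable_continuous_real[OF t_cont_Icc[of 0 x]]
  by (intro set_lebesgue_integral_eq_integral(2)) auto

lemma T_diff:
  assumes "0 \<le> x" "x \<le> y"
  shows "(y - x) * t x \<le> T y - T x"
proof -
  have "T x + integral {x..y} t = T y"
    unfolding T_def using assms by (intro Henstock_Kurzweil_Integration.integral_combine t_integrable) auto
  moreover have "integral {x..y} (\<lambda>_. t x) \<le> integral {x..y} t"
    using assms t_le_iff by (intro integral_le t_integrable) auto
  ultimately show ?thesis using assms by (simp add: mult.commute)
qed

lemma T_pos:
  assumes "0 < x"
  shows "0 < T x"
proof -
  have "0 \<le> T (x / 2)" using T_diff[of 0 "x / 2"] assms by (simp add: t_0 T_def)
  moreover have "0 < (x - x / 2) * t (x / 2)" using t_pos[of "x / 2"] assms by simp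
  ultimately show ?thesis using T_diff[of "x / 2" x] assms by linarith
qed

lemma T_mono: "0 \<le> x \<Longrightarrow> x \<le> y \<Longrightarrow> T x \<le> T y"
  using T_diff[of x y] t_nonneg[of x] by (smt (verit) mult_nonneg_nonneg)

lemma kernel_integrable:
  fixes h :: "real \<Rightarrow> real"
  assumes x: "0 \<le> x" and h: "continuous_on {0..} h"
  shows "integrable (kernel x) (\<lambda>v. h (max 0 v))"
proof -
  interpret prob_space "kernel x" by (rule kernel_prob)
  have "compact (h ` {0..x})"
    by (intro compact_continuous_image continuous_on_subset[OF h]) auto
  then have "bounded (h ` {0..x})" by (rule compact_imp_bounded)
  then obtain B where B: "\<forall>v\<in>{0..x}. \<bar>h v\<bar> \<le> B" by (auto simp: bounded_iff)
  show ?thesis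
  proof (rule integrable_const_bound)
    show "AE v in kernel x. norm (h (max 0 v)) \<le> B"
      using AE_kernel[OF x] by eventually_elim (use B in auto)
    show "(\<lambda>v. h (max 0 v)) \<in> borel_measurable (kernel x)"
      using clamp_measurable[OF h] by simp
  qed
qed

text \<open>
  All the laws \<open>kernel x\<close> are driven by one uniform variable; this is what allows them to be
  coupled.
\<close>

lemma kernel_avg_unif:
  assumes h: "continuous_on {0..} h"
  shows "kernel_avg h x = (\<integral>u. h (max 0 (quantile x u)) \<partial>unif)"
  unfolding kernel_avg_def kernel_def
  using clamp_measurable[OF h] by (subst integral_distr) auto

lemma unif_integrable:
  fixes h :: "real \<Rightarrow> real"
  assumes x: "0 \<le> x" and h: "continuous_on {0..} h"
  shows "integrable unif (\<lambda>u. h (max 0 (quantile x u)))"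
  using kernel_integrable[OF assms] clamp_measurable[OF h] unfolding kernel_def
  by (subst (asm) integrable_distr_eq) auto

text \<open>
  Integrating \<open>x - v\<close> against the kernel is integrating its distribution function over
  \<open>[0, x]\<close>, by Fubini's theorem on the triangle \<open>v \<le> u \<le> x\<close>.
\<close>

lemma kernel_avg_id:
  assumes x: "0 < x"
  shows "kernel_avg (\<lambda>v. v) x = x - T x / t x"
proof -
  interpret K: prob_space "kernel x" by (rule kernel_prob)
  interpret P: pair_sigma_finite "kernel x" lborel ..
  have tx: "0 < t x" using x by (rule t_pos)
  have Tx: "0 < T x" using x by (rule T_pos)
  define S where "S = {(v, u). 0 \<le> u \<and> v \<le> u \<and> u \<le> x}"
  have "closed S"
    unfolding S_def case_prod_unfold
    by (intro closed_Collect_conj closed_Collect_le continuous_intros)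
  then have "S \<in> sets (borel \<Otimes>\<^sub>M borel)"
    unfolding borel_prod by (rule borel_closed)
  also have "sets (borel \<Otimes>\<^sub>M borel) = sets (kernel x \<Otimes>\<^sub>M lborel)"
    by (intro sets_pair_measure_cong) auto
  finally have S[measurable]: "S \<in> sets (kernel x \<Otimes>\<^sub>M lborel)" .
  have int: "integrable (kernel x) (\<lambda>v. max 0 v)"
    using kernel_integrable[of x "\<lambda>v. v"] x by (simp add: continuous_on_id)
  then have int': "integrable (kernel x) (\<lambda>v. x - max 0 v)" by simp
  have "(\<integral>\<^sup>+v. ennreal (x - max 0 v) \<partial>kernel x) = (\<integral>\<^sup>+v. (\<integral>\<^sup>+u. indicator S (v, u) \<partial>lborel) \<partial>kernel x)"
  proof (rule nn_integral_cong_AE)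
    show "AE v in kernel x. ennreal (x - max 0 v) = (\<integral>\<^sup>+u. indicator S (v, u) \<partial>lborel)"
      using AE_kernel[OF less_imp_le[OF x]]
    proof eventually_elim
      case (elim v)
      have "(\<integral>\<^sup>+u. indicator S (v, u) \<partial>lborel) = (\<integral>\<^sup>+u. indicator {v..x} u \<partial>lborel)"
        using elim by (intro nn_integral_cong) (auto simp: S_def indicator_def)
      then show ?case using elim by simp
    qed
  qed
  also have "\<dots> = (\<integral>\<^sup>+u. (\<integral>\<^sup>+v. indicator S (v, u) \<partial>kernel x) \<partial>lborel)"
    by (rule P.Fubini[symmetric]) measurable
  also have "\<dots> = (\<integral>\<^sup>+u. ennreal (indicator {0..x} u * (t u / t x)) \<partial>lborel)"
  proof (rule nn_integral_cong)
    fix u :: real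
    have "(\<integral>\<^sup>+v. indicator S (v, u) \<partial>kernel x) = (\<integral>\<^sup>+v. indicator {0..x} u * indicator {..u} v \<partial>kernel x)"
      by (intro nn_integral_cong) (auto simp: S_def indicator_def)
    also have "\<dots> = indicator {0..x} u * emeasure (kernel x) {..u}"
      by (subst nn_integral_cmult) auto
    also have "\<dots> = ennreal (indicator {0..x} u * (t u / t x))"
      using kernel_atMost[of x u] x by (auto simp: K.emeasure_eq_measure indicator_def)
    finally show "(\<integral>\<^sup>+v. indicator S (v, u) \<partial>kernel x) = ennreal (indicator {0..x} u * (t u / t x))" .
  qed
  also have "\<dots> = ennreal (T x / t x)"
  proof -
    have si: "set_integrable lborel {0..x} t"
      by (rule borel_integrable_atLeastAtMost'[OF t_cont_Icc]) simp
    then have "integrable lborel (\<lambda>u. (indicator {0..x} u *\<^sub>R t u) / t x)"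
      unfolding set_integrable_def by (intro integrable_divide)
    then have "integrable lborel (\<lambda>u. indicator {0..x} u * (t u / t x))" by simp
    then have "(\<integral>\<^sup>+u. ennreal (indicator {0..x} u * (t u / t x)) \<partial>lborel)
        = ennreal (\<integral>u. indicator {0..x} u * (t u / t x) \<partial>lborel)"
      using t_nonneg by (intro nn_integral_eq_integral) auto
    also have "(\<integral>u. indicator {0..x} u * (t u / t x) \<partial>lborel) = T x / t x"
      using set_borel_integral_eq_integral(2)[OF si] unfolding T_def set_lebesgue_integral_def by simp
    finally show ?thesis .
  qed
  finally have nn: "(\<integral>\<^sup>+v. ennreal (x - max 0 v) \<partial>kernel x) = ennreal (T x / t x)" .
  have AE_nn: "AE v in kernel x. 0 \<le> x - max 0 v"
    using AE_kernel[OF less_imp_le[OF x]] by eventually_elim (use x in auto)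
  have "ennreal (\<integral>v. x - max 0 v \<partial>kernel x) = ennreal (T x / t x)"
    using nn nn_integral_eq_integral[OF int' AE_nn] by simp
  then have "(\<integral>v. x - max 0 v \<partial>kernel x) = T x / t x"
    using integral_nonneg_AE[OF AE_nn] tx Tx by (subst (asm) ennreal_inj) auto
  moreover have "(\<integral>v. x - max 0 v \<partial>kernel x) = x - (\<integral>v. max 0 v \<partial>kernel x)"
    using int K.prob_space by simp
  ultimately show ?thesis unfolding kernel_avg_def by simp
qed

lemma quantile_mono:
  assumes "0 \<le> x" "x \<le> y" "0 \<le> u" "u \<le> 1"
  shows "quantile x u \<le> quantile y u"
proof -
  have "u * t x \<le> u * t y" using assms t_le_iff[of x y] by (intro mult_left_mono) auto
  then show ?thesis using assms quantile_spec[of x u] quantile_spec[of y u] t_le_iff[of "quantile x u" "quantile y u"] by simp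
qed

text \<open>
  The coupling by quantiles is monotone in \<open>x\<close>, so the expected distance between the two coupled
  points is the difference of their means. Therefore the identity is the extremal Lipschitz
  function for the averaging operator.
\<close>

lemma kernel_avg_coupling:
  assumes h: "L-lipschitz_on {0..} h" and xy: "0 \<le> x" "x \<le> y"
  shows "\<bar>kernel_avg h y - kernel_avg h x\<bar> \<le> L * (kernel_avg (\<lambda>v. v) y - kernel_avg (\<lambda>v. v) x)"
proof -
  have hc: "continuous_on {0..} h" using h by (rule lipschitz_on_continuous_on)
  have ic: "continuous_on {0..} (\<lambda>v::real. v)" by simp
  have y: "0 \<le> y" using xy by simp
  note ints = unif_integrable[OF xy(1) hc] unif_integrable[OF y hc] unif_integrable[OF xy(1) ic] unif_integrable[OF y ic]
  have pointwise: "\<bar>h (max 0 (quantile y u)) - h (max 0 (quantile x u))\<bar> \<le> L * (max 0 (quantile y u) - max 0 (quantile x u))"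
    if "0 \<le> u \<and> u \<le> 1" for u
  proof -
    have le: "quantile x u \<le> quantile y u" using quantile_mono[of x y u] xy that by simp
    have "\<bar>h (max 0 (quantile y u)) - h (max 0 (quantile x u))\<bar> \<le> L * \<bar>max 0 (quantile y u) - max 0 (quantile x u)\<bar>"
      using lipschitz_onD[OF h, of "max 0 (quantile y u)" "max 0 (quantile x u)"] by (simp add: dist_real_def)
    also have "\<bar>max 0 (quantile y u) - max 0 (quantile x u)\<bar> = max 0 (quantile y u) - max 0 (quantile x u)"
      using le by (simp add: max_def)
    finally show ?thesis .
  qed
  have "\<bar>kernel_avg h y - kernel_avg h x\<bar> = \<bar>\<integral>u. h (max 0 (quantile y u)) - h (max 0 (quantile x u)) \<partial>unif\<bar>"
    unfolding kernel_avg_unif[OF hc] using ints by simp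
  also have "\<dots> \<le> (\<integral>u. \<bar>h (max 0 (quantile y u)) - h (max 0 (quantile x u))\<bar> \<partial>unif)"
    by (rule integral_abs_bound)
  also have "\<dots> \<le> (\<integral>u. L * (max 0 (quantile y u) - max 0 (quantile x u)) \<partial>unif)"
  proof (rule integral_mono_AE)
    show "AE u in unif. \<bar>h (max 0 (quantile y u)) - h (max 0 (quantile x u))\<bar> \<le> L * (max 0 (quantile y u) - max 0 (quantile x u))"
      using AE_unif by (rule eventually_mono) (rule pointwise)
    show "integrable unif (\<lambda>u. \<bar>h (max 0 (quantile y u)) - h (max 0 (quantile x u))\<bar>)"
      using ints by simp
    show "integrable unif (\<lambda>u. L * (max 0 (quantile y u) - max 0 (quantile x u)))"
      using ints by simp
  qed
  also have "\<dots> = L * (kernel_avg (\<lambda>v. v) y - kernel_avg (\<lambda>v. v) x)"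
    unfolding kernel_avg_unif[OF ic] using ints by simp
  finally show ?thesis .
qed

end

section \<open>Contraction of Lipschitz constants\<close>

locale contracting_scale = scale_function +
  fixes \<rho> :: real
  assumes rho_nonneg: "0 \<le> \<rho>"
    and ratio_bound: "AE x in lborel. 0 < x \<longrightarrow> ratio_I t x \<le> \<rho>"
begin

text \<open>
  The ratio bound reads \<open>t' \<le> \<rho> t\<^sup>2 / T\<close>; since \<open>t\<close> and \<open>T\<close> increase, on \<open>[x, y]\<close> the right-hand
  side is at most \<open>\<rho> t(y)\<^sup>2 / T(x)\<close>. The increment of \<open>t\<close> is the integral of \<open>t'\<close>, expressed
  here through the density of \<open>kernel y\<close>.
\<close>

lemma t_increment:
  assumes x: "0 < x" and xy: "x \<le> y"
  shows "t y - t x \<le> \<rho> * (t y)\<^sup>2 / T x * (y - x)"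
proof -
  have y: "0 < y" using x xy by simp
  have tx: "0 < t x" and ty: "0 < t y" using x y t_pos by auto
  have Tx: "0 < T x" using x by (rule T_pos)
  interpret K: prob_space "kernel y" by (rule kernel_prob)
  obtain d where d[measurable]: "d \<in> borel_measurable borel" and d_nn: "\<And>v. 0 \<le> d v"
    and K: "kernel y = density lborel (\<lambda>v. ennreal (d v))"
    and dd: "AE v in lborel. 0 < v \<and> v < y \<longrightarrow> deriv t v = t y * d v"
    using kernel_density[OF y] by blast
  define c where "c = \<rho> * t y / T x"
  have c: "0 \<le> c" unfolding c_def using rho_nonneg ty Tx by simp
  have bound: "AE v in lborel. ennreal (d v) * indicator {x..y} v \<le> ennreal c * indicator {x..y} v"
    using dd ratio_bound AE_lborel_singleton[of y]
  proof eventually_elim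
    case (elim v)
    show ?case
    proof (cases "v \<in> {x..y}")
      case True
      then have v: "x \<le> v" "v < y" "0 < v" using elim x by auto
      have tv: "0 < t v" "t v \<le> t y" using v y t_pos t_le_iff[of v y] by auto
      have Tv: "0 < T v" "T x \<le> T v" using v x T_pos T_mono by auto
      have "ratio_I t v \<le> \<rho>" using elim v by simp
      then have "deriv t v * T v \<le> \<rho> * (t v)\<^sup>2"
        using tv unfolding ratio_I_def set_lebesgue_integral_t by (simp add: field_simps)
      moreover have "deriv t v = t y * d v" using elim v by simp
      ultimately have "t y * d v * T v \<le> \<rho> * (t v)\<^sup>2" by simp
      moreover have "t y * d v * T x \<le> t y * d v * T v"
        using Tv ty d_nn by (intro mult_left_mono) auto
      moreover have "\<rho> * (t v)\<^sup>2 \<le> \<rho> * (t y)\<^sup>2"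
        using tv rho_nonneg by (intro mult_left_mono power_mono) auto
      ultimately have "t y * (d v * T x) \<le> t y * (\<rho> * t y)" by (simp add: power2_eq_square mult_ac)
      then have "d v * T x \<le> \<rho> * t y" using ty by simp
      then have "d v \<le> c" unfolding c_def using Tx by (simp add: field_simps)
      then show ?thesis by (auto intro!: mult_right_mono ennreal_leI)
    qed simp
  qed
  have "emeasure (kernel y) {x..y} = (\<integral>\<^sup>+v. ennreal (d v) * indicator {x..y} v \<partial>lborel)"
    unfolding K by (subst emeasure_density) auto
  also have "\<dots> \<le> (\<integral>\<^sup>+v. ennreal c * indicator {x..y} v \<partial>lborel)"
    by (rule nn_integral_mono_AE[OF bound])
  also have "\<dots> = ennreal (c * (y - x))"
    using xy c by (simp add: nn_integral_cmult ennreal_mult)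
  finally have "ennreal (measure (kernel y) {x..y}) \<le> ennreal (c * (y - x))"
    by (simp add: K.emeasure_eq_measure)
  then have "measure (kernel y) {x..y} \<le> c * (y - x)" using c xy by simp
  then have "(t y - t x) / t y \<le> c * (y - x)" using kernel_Icc[of y x y] x y xy by simp
  then show ?thesis using ty unfolding c_def by (simp add: field_simps power2_eq_square)
qed

text \<open>
  In \<open>kernel_avg (\<lambda>v. v) x = x - T x / t x\<close> the increments of \<open>T\<close> and of \<open>t\<close> pull in opposite
  directions. The factor obtained tends to \<open>\<rho>\<close> as \<open>x\<close> and \<open>y\<close> approach a common point, so
  this is a derivative bound in integrated form.
\<close>

lemma kernel_avg_id_increment:
  assumes x: "0 < x" and xy: "x \<le> y"
  shows "kernel_avg (\<lambda>v. v) y - kernel_avg (\<lambda>v. v) x \<le> (1 - t x / t y + \<rho> * (t y / t x)) * (y - x)"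
proof -
  have y: "0 < y" using x xy by simp
  have tx: "0 < t x" and ty: "0 < t y" using x y t_pos by auto
  have Tx: "0 < T x" using x by (rule T_pos)
  have "kernel_avg (\<lambda>v. v) y - kernel_avg (\<lambda>v. v) x
      = (y - x) - (T y - T x) / t y + T x / (t x * t y) * (t y - t x)"
    unfolding kernel_avg_id[OF x] kernel_avg_id[OF y] using tx ty by (simp add: field_simps)
  also have "\<dots> \<le> (y - x) - (y - x) * t x / t y + T x / (t x * t y) * (\<rho> * (t y)\<^sup>2 / T x * (y - x))"
    using T_diff[of x y] t_increment[OF x xy] x xy tx ty Tx
    by (intro add_mono diff_left_mono mult_left_mono divide_right_mono) auto
  also have "\<dots> = (1 - t x / t y + \<rho> * (t y / t x)) * (y - x)"
    using tx ty Tx by (simp add: field_simps power2_eq_square)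
  finally show ?thesis .
qed

text \<open>
  A local growth rate below \<open>c\<close>, for every \<open>c > \<rho>\<close>, near each point of a compact interval is a
  global one, by bisection. Arguing in this way avoids differentiating \<open>T / t\<close>.
\<close>

lemma kernel_avg_id_lipschitz:
  assumes x: "0 < x" and xy: "x \<le> y"
  shows "kernel_avg (\<lambda>v. v) y - kernel_avg (\<lambda>v. v) x \<le> \<rho> * (y - x)"
proof -
  define G where "G = kernel_avg (\<lambda>v. v)"
  have G: "G y - G x \<le> c * (y - x)" if c: "\<rho> < c" for c
    using xy
  proof (induction rule: Bolzano)
    case (trans p q r)
    then show ?case by (simp add: algebra_simps)
  next
    case (local z)
    then have z: "0 < z" using x by simp
    have tz: "0 < t z" using z by (rule t_pos)
    \<comment> \<open>at a point the bound of \<open>kernel_avg_id_increment\<close> has the limit \<open>\<rho> < c\<close>\<close>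
    have cont: "isCont t z"
      using continuous_on_interior[OF t_cont] z by (simp add: interior_real_atLeast)
    have lim_r: "((\<lambda>\<delta>. t (z + \<delta>)) \<longlongrightarrow> t z) (at_right 0)"
      using z by (intro isCont_tendsto_compose[OF cont]) (auto intro!: tendsto_eq_intros)
    have lim_l: "((\<lambda>\<delta>. t (z - \<delta>)) \<longlongrightarrow> t z) (at_right 0)"
      using z by (intro isCont_tendsto_compose[OF cont]) (auto intro!: tendsto_eq_intros)
    have "((\<lambda>\<delta>. 1 - t (z - \<delta>) / t (z + \<delta>) + \<rho> * (t (z + \<delta>) / t (z - \<delta>)))
        \<longlongrightarrow> 1 - t z / t z + \<rho> * (t z / t z)) (at_right 0)"
      using tz by (intro tendsto_intros lim_r lim_l) auto
    moreover have "1 - t z / t z + \<rho> * (t z / t z) < c" using tz c by simp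
    ultimately have "\<forall>\<^sub>F \<delta> in at_right 0. 1 - t (z - \<delta>) / t (z + \<delta>) + \<rho> * (t (z + \<delta>) / t (z - \<delta>)) < c"
      by (rule order_tendstoD(2))
    \<comment> \<open>the intervals around \<open>z\<close> may extend to the left of \<open>x\<close>, but have to stay in the positive half-line\<close>
    moreover have "\<forall>\<^sub>F \<delta> in at_right 0. \<delta> < z"
      using z by (auto simp: eventually_at_right_field)
    moreover have "\<forall>\<^sub>F \<delta> in at_right (0::real). 0 < \<delta>"
      by (rule eventually_at_right_less)
    ultimately have "\<forall>\<^sub>F \<delta> in at_right 0. 0 < \<delta> \<and> \<delta> < z \<and>
        1 - t (z - \<delta>) / t (z + \<delta>) + \<rho> * (t (z + \<delta>) / t (z - \<delta>)) < c"
      by eventually_elim auto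
    then obtain \<delta> where \<delta>: "0 < \<delta>" "\<delta> < z"
        "1 - t (z - \<delta>) / t (z + \<delta>) + \<rho> * (t (z + \<delta>) / t (z - \<delta>)) < c"
      using eventually_happens by (metis (mono_tags, lifting) trivial_limit_at_right_real)
    show ?case
    proof (intro exI[of _ \<delta>] conjI allI impI)
      show "0 < \<delta>" by fact
      fix p q assume pq: "p \<le> z \<and> z \<le> q \<and> q - p < \<delta>"
      then have pos: "0 < p" "p \<le> q" "0 < z - \<delta>" using \<delta> by auto
      have t_pq: "t (z - \<delta>) \<le> t p" "t q \<le> t (z + \<delta>)" "t p \<le> t q" "0 < t (z - \<delta>)"
        using pq pos \<delta> z t_pos by (auto simp: t_le_iff)
      have "t (z - \<delta>) / t (z + \<delta>) \<le> t p / t q"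
        using t_pq by (intro frac_le) auto
      moreover have "\<rho> * (t q / t p) \<le> \<rho> * (t (z + \<delta>) / t (z - \<delta>))"
        using t_pq rho_nonneg by (intro mult_left_mono frac_le) auto
      ultimately have "1 - t p / t q + \<rho> * (t q / t p) \<le> c" using \<delta>(3) by linarith
      then have "(1 - t p / t q + \<rho> * (t q / t p)) * (q - p) \<le> c * (q - p)"
        using pos by (intro mult_right_mono) auto
      then show "G q - G p \<le> c * (q - p)"
        using kernel_avg_id_increment[OF pos(1,2)] unfolding G_def by linarith
    qed
  qed
  have "((\<lambda>c. c * (y - x)) \<longlongrightarrow> \<rho> * (y - x)) (at_right \<rho>)"
    by (intro tendsto_intros)
  then have "G y - G x \<le> \<rho> * (y - x)"
    by (rule tendsto_lowerbound) (auto intro: eventually_mono[OF eventually_at_right_less] G)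
  then show ?thesis by (simp add: G_def)
qed

text \<open>
  By the coupling it is enough to know the effect on the identity. The domain excludes the origin,
  where the averaging operator is defined by a separate convention.
\<close>

lemma avg_op_lipschitz:
  assumes h: "L-lipschitz_on {0..} h"
  shows "(L * \<rho>)-lipschitz_on {0<..} (avg_op t h)"
proof -
  have hc: "continuous_on {0..} h" using h by (rule lipschitz_on_continuous_on)
  have L: "0 \<le> L" using h by (rule lipschitz_on_nonneg)
  have le: "\<bar>avg_op t h y - avg_op t h x\<bar> \<le> L * \<rho> * (y - x)" if "0 < x" "x \<le> y" for x y
  proof -
    have "\<bar>avg_op t h y - avg_op t h x\<bar> = \<bar>kernel_avg h y - kernel_avg h x\<bar>"
      using avg_op_kernel[OF _ hc] that by (simp add: kernel_avg_def)
    also have "\<dots> \<le> L * (kernel_avg (\<lambda>v. v) y - kernel_avg (\<lambda>v. v) x)"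
      using that by (intro kernel_avg_coupling[OF h]) auto
    also have "\<dots> \<le> L * (\<rho> * (y - x))"
      using L that by (intro mult_left_mono kernel_avg_id_lipschitz) auto
    finally show ?thesis by (simp add: mult.assoc)
  qed
  show ?thesis
  proof (rule lipschitz_onI)
    show "dist (avg_op t h x) (avg_op t h y) \<le> L * \<rho> * dist x y" if "x \<in> {0<..}" "y \<in> {0<..}" for x y
      using le[of x y] le[of y x] that by (cases "x \<le> y") (auto simp: dist_real_def abs_minus_commute)
    show "0 \<le> L * \<rho>" using L rho_nonneg by simp
  qed
qed

end

section \<open>Invariance of the perpetuity law\<close>

text \<open>
  Conditionally on \<open>D = w\<close>, the variable \<open>s\<inverse>(U\<^sup>1\<^sup>/\<^sup>\<theta> s(D + 1))\<close> has law \<open>kernel (w + 1)\<close>.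
  Integrating out \<open>U\<close> in the distributional fixed-point equation gives the claim.
\<close>

lemma (in scale_function) perpetuity_avg_invariant:
  assumes D: "perpetuity_rv \<theta> s M D" and h: "continuous_on {0..} h"
    and int: "integrable M (\<lambda>w. h (D w))"
  shows "(\<integral>w. avg_op t h (D w + 1) \<partial>M) = (\<integral>w. h (D w) \<partial>M)"
proof -
  note D' = D[unfolded perpetuity_rv_def]
  have M: "prob_space M" and Dm[measurable]: "D \<in> borel_measurable M" and D_nn: "\<And>w. w \<in> space M \<Longrightarrow> 0 \<le> D w"
    using D' by blast+
  have D_eq: "distr M borel D = distr (unif \<Otimes>\<^sub>M M) borel
         (\<lambda>(u, w). inv_into {0..} s (u powr (1 / \<theta>) * s (D w + 1)))"
    using D' by (elim conjE)
  interpret M: prob_space M by (rule M)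
  interpret U: prob_space unif by (rule unif_prob)
  interpret P: pair_prob_space unif M ..
  define Q where "Q = (\<lambda>(u, w). quantile (D w + 1) u)"
  have hm: "(\<lambda>v. h (max 0 v)) \<in> borel_measurable borel" using h by (rule clamp_measurable)
  have sm[measurable]: "(\<lambda>v. s (max 0 v)) \<in> borel_measurable borel" using s_cont by (rule clamp_measurable)
  \<comment> \<open>\<open>s\<close> is known to be measurable only after clamping, which changes nothing on the space of \<open>M\<close>\<close>
  have "(\<lambda>(u, w). inv_into {0..} s (u powr (1 / \<theta>) * s (max 0 (D w + 1)))) \<in> borel_measurable (unif \<Otimes>\<^sub>M M)"
    by measurable
  also have "?this \<longleftrightarrow> Q \<in> borel_measurable (unif \<Otimes>\<^sub>M M)"
    unfolding Q_def quantile_def using D_nn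
    by (intro measurable_cong) (auto simp: space_pair_measure max_def)
  finally have Qm: "Q \<in> borel_measurable (unif \<Otimes>\<^sub>M M)" .
  have D_eq': "distr M borel D = distr (unif \<Otimes>\<^sub>M M) borel Q"
    unfolding D_eq Q_def quantile_def ..
  have eq_h: "h (max 0 (D w)) = h (D w)" if "w \<in> space M" for w using D_nn[OF that] by (simp add: max_def)
  have "integrable M (\<lambda>w. h (max 0 (D w))) \<longleftrightarrow> integrable M (\<lambda>w. h (D w))"
    using eq_h by (intro Bochner_Integration.integrable_cong) auto
  then have "integrable (distr M borel D) (\<lambda>v. h (max 0 v))"
    using int hm by (subst integrable_distr_eq) auto
  then have "integrable (unif \<Otimes>\<^sub>M M) (\<lambda>p. h (max 0 (Q p)))"
    unfolding D_eq' using hm Qm by (subst (asm) integrable_distr_eq) auto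
  then have intQ: "integrable (unif \<Otimes>\<^sub>M M) (\<lambda>(u, w). h (max 0 (quantile (D w + 1) u)))"
    by (simp add: Q_def case_prod_unfold)
  have "(\<integral>w. h (D w) \<partial>M) = (\<integral>w. h (max 0 (D w)) \<partial>M)"
    using eq_h by (intro Bochner_Integration.integral_cong) auto
  also have "\<dots> = (\<integral>v. h (max 0 v) \<partial>distr M borel D)"
    using hm by (subst integral_distr) auto
  also have "\<dots> = (\<integral>p. h (max 0 (Q p)) \<partial>(unif \<Otimes>\<^sub>M M))"
    unfolding D_eq' using hm Qm by (subst integral_distr) auto
  also have "\<dots> = (\<integral>w. (\<integral>u. h (max 0 (quantile (D w + 1) u)) \<partial>unif) \<partial>M)"
    using P.integral_snd[OF intQ] by (simp add: Q_def case_prod_unfold)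
  also have "\<dots> = (\<integral>w. avg_op t h (D w + 1) \<partial>M)"
  proof (rule Bochner_Integration.integral_cong[OF refl])
    fix w assume "w \<in> space M"
    then have "0 < D w + 1" using D_nn[of w] by simp
    then show "(\<integral>u. h (max 0 (quantile (D w + 1) u)) \<partial>unif) = avg_op t h (D w + 1)"
      using avg_op_kernel[OF _ h] kernel_avg_unif[OF h] by (simp add: kernel_avg_def)
  qed
  finally show ?thesis by simp
qed

section \<open>The series solution\<close>

lemma lipschitz_integrable:
  assumes M: "prob_space M" and D: "integrable M D" and D_nn: "\<And>w. w \<in> space M \<Longrightarrow> 0 \<le> D w"
    and h: "L-lipschitz_on {0..} (h :: real \<Rightarrow> real)"
  shows "integrable M (\<lambda>w. h (D w))"
proof -
  interpret prob_space M by (rule M)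
  have [measurable]: "D \<in> borel_measurable M" using D by simp
  have "(\<lambda>v. h (max 0 v)) \<in> borel_measurable borel"
    by (rule clamp_measurable[OF lipschitz_on_continuous_on[OF h]])
  then have m: "(\<lambda>w. h (max 0 (D w))) \<in> borel_measurable M" by measurable
  have "integrable M (\<lambda>w. h (max 0 (D w)))"
  proof (rule Bochner_Integration.integrable_bound)
    show "integrable M (\<lambda>w. \<bar>h 0\<bar> + L * D w)" using D by simp
    show "AE w in M. norm (h (max 0 (D w))) \<le> norm (\<bar>h 0\<bar> + L * D w)"
    proof (rule AE_I2)
      fix w assume "w \<in> space M"
      then have "0 \<le> D w" by (rule D_nn)
      moreover from this have "\<bar>h (D w) - h 0\<bar> \<le> L * D w"
        using lipschitz_onD[OF h, of "D w" 0] by (simp add: dist_real_def)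
      ultimately show "norm (h (max 0 (D w))) \<le> norm (\<bar>h 0\<bar> + L * D w)" by (simp add: max_def)
    qed
  qed (rule m)
  also have "?this \<longleftrightarrow> integrable M (\<lambda>w. h (D w))"
    using D_nn by (intro Bochner_Integration.integrable_cong) (auto simp: max_def)
  finally show ?thesis .
qed

locale centred_perpetuity = contracting_scale +
  fixes M :: "'a measure" and D :: "'a \<Rightarrow> real" and h :: "real \<Rightarrow> real"
  assumes perpetuity: "perpetuity_rv \<theta> s M D"
    and mean: "integrable M D"
    and rho_less_1: "\<rho> < 1"
    and h_lip: "1-lipschitz_on {0..} h"
    and h_mean: "(\<integral>w. h (D w) \<partial>M) = 0"
begin

lemma M_prob: "prob_space M"
  using perpetuity by (simp add: perpetuity_rv_def)

lemma D_nonneg: "w \<in> space M \<Longrightarrow> 0 \<le> D w"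
  using perpetuity by (simp add: perpetuity_rv_def)

definition \<mu> :: real where
  "\<mu> = (\<integral>w. D w \<partial>M)"

lemma avg_iter_lipschitz: "(\<rho> ^ k)-lipschitz_on {0..} (avg_iter t h k)"
proof (induction k)
  case 0
  then show ?case using h_lip by (simp add: avg_iter.simps[abs_def])
next
  case (Suc k)
  have lip: "(\<rho> ^ Suc k)-lipschitz_on {0<..} (avg_op t (avg_iter t h k))"
    using avg_op_lipschitz[OF Suc.IH] by (simp add: mult.commute)
  show ?case
  proof (rule lipschitz_onI)
    show "dist (avg_iter t h (Suc k) x) (avg_iter t h (Suc k) y) \<le> \<rho> ^ Suc k * dist x y"
      if "x \<in> {0..}" "y \<in> {0..}" for x y
      using lipschitz_onD[OF lip, of "x + 1" "y + 1"] that by simp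
    show "0 \<le> \<rho> ^ Suc k" using rho_nonneg by simp
  qed
qed

lemma avg_iter_continuous: "continuous_on {0..} (avg_iter t h k)"
  using avg_iter_lipschitz by (rule lipschitz_on_continuous_on)

lemma avg_iter_integrable: "integrable M (\<lambda>w. avg_iter t h k (D w))"
  using M_prob mean D_nonneg avg_iter_lipschitz by (rule lipschitz_integrable)

text \<open>
  The law of \<open>D\<close> is invariant under the averaging kernel, so each iterate inherits mean zero.
\<close>

lemma avg_iter_mean: "(\<integral>w. avg_iter t h k (D w) \<partial>M) = 0"
proof (induction k)
  case 0
  then show ?case using h_mean by simp
next
  case (Suc k)
  then show ?case
    using perpetuity_avg_invariant[OF perpetuity avg_iter_continuous avg_iter_integrable, of k] by simp
qed

text \<open>
  A Lipschitz function of mean zero is controlled by the mean distance to \<open>D\<close>: subtracting its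
  mean, its value at \<open>x\<close> is at most \<open>\<rho>\<^sup>k E|x - D| \<le> \<rho>\<^sup>k (x + \<mu>)\<close>.
\<close>

lemma avg_iter_bound:
  assumes x: "0 \<le> x"
  shows "\<bar>avg_iter t h k x\<bar> \<le> (\<mu> + x) * \<rho> ^ k"
proof -
  interpret prob_space M by (rule M_prob)
  have rk: "0 \<le> \<rho> ^ k" using rho_nonneg by simp
  have "avg_iter t h k x = (\<integral>w. avg_iter t h k x - avg_iter t h k (D w) \<partial>M)"
    using avg_iter_integrable[of k] avg_iter_mean[of k] by (simp add: prob_space)
  then have "\<bar>avg_iter t h k x\<bar> = \<bar>\<integral>w. avg_iter t h k x - avg_iter t h k (D w) \<partial>M\<bar>" by simp
  also have "\<dots> \<le> (\<integral>w. \<bar>avg_iter t h k x - avg_iter t h k (D w)\<bar> \<partial>M)"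
    by (rule integral_abs_bound)
  also have "\<dots> \<le> (\<integral>w. \<rho> ^ k * (x + D w) \<partial>M)"
  proof (rule integral_mono)
    show "integrable M (\<lambda>w. \<bar>avg_iter t h k x - avg_iter t h k (D w)\<bar>)"
      using avg_iter_integrable by simp
    show "integrable M (\<lambda>w. \<rho> ^ k * (x + D w))" using mean by simp
    fix w assume "w \<in> space M"
    then have Dw: "0 \<le> D w" by (rule D_nonneg)
    then have "\<bar>avg_iter t h k x - avg_iter t h k (D w)\<bar> \<le> \<rho> ^ k * \<bar>x - D w\<bar>"
      using lipschitz_onD[OF avg_iter_lipschitz, of x "D w" k] x by (simp add: dist_real_def)
    also have "\<dots> \<le> \<rho> ^ k * (x + D w)" using rk Dw x by (intro mult_left_mono) auto
    finally show "\<bar>avg_iter t h k x - avg_iter t h k (D w)\<bar> \<le> \<rho> ^ k * (x + D w)" .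
  qed
  also have "\<dots> = (\<mu> + x) * \<rho> ^ k" using mean by (simp add: prob_space \<mu>_def)
  finally show ?thesis .
qed

lemma geometric_summable: "summable (\<lambda>k. c * \<rho> ^ k)"
  using rho_nonneg rho_less_1 by (intro summable_mult summable_geometric) simp

lemma avg_iter_summable:
  assumes x: "0 \<le> x"
  shows "summable (\<lambda>k. \<bar>avg_iter t h k x\<bar>)"
  by (rule summable_comparison_test[OF _ geometric_summable[of "\<mu> + x"]])
    (use avg_iter_bound[OF x] in auto)

lemma partial_sum_lipschitz:
  "((1 - \<rho> ^ (n + 1)) / (1 - \<rho>))-lipschitz_on {0..} (\<lambda>x. \<Sum>k\<le>n. avg_iter t h k x)"
proof -
  have "(\<Sum>k\<le>n. \<rho> ^ k)-lipschitz_on {0..} (\<lambda>x. \<Sum>k\<le>n. avg_iter t h k x)"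
  proof (induction n)
    case 0
    then show ?case using avg_iter_lipschitz[of 0] by simp
  next
    case (Suc n)
    then show ?case using lipschitz_on_add[OF Suc avg_iter_lipschitz[of "Suc n"]] by simp
  qed
  moreover have "(\<Sum>k\<le>n. \<rho> ^ k) = (1 - \<rho> ^ (n + 1)) / (1 - \<rho>)"
    using rho_less_1 by (simp add: sum_gp0)
  ultimately show ?thesis by simp
qed

definition g :: "real \<Rightarrow> real" where
  "g x = (\<Sum>k. avg_iter t h k x)"

lemma g_lipschitz: "(1 / (1 - \<rho>))-lipschitz_on {0..} g"
proof (rule lipschitz_onI)
  show "0 \<le> 1 / (1 - \<rho>)" using rho_less_1 by simp
  fix x y :: real assume xy: "x \<in> {0..}" "y \<in> {0..}"
  have sum: "summable (\<lambda>k. avg_iter t h k x)" "summable (\<lambda>k. avg_iter t h k y)"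
    using avg_iter_summable xy by (auto intro: summable_rabs_cancel)
  have "norm (\<Sum>k. avg_iter t h k x - avg_iter t h k y) \<le> (\<Sum>k. dist x y * \<rho> ^ k)"
  proof (rule norm_suminf_le[OF _ geometric_summable])
    show "norm (avg_iter t h k x - avg_iter t h k y) \<le> dist x y * \<rho> ^ k" for k
      using lipschitz_onD[OF avg_iter_lipschitz, of x y k] xy by (simp add: dist_norm mult.commute)
  qed
  also have "(\<Sum>k. dist x y * \<rho> ^ k) = dist x y * (1 / (1 - \<rho>))"
    using rho_nonneg rho_less_1 by (subst suminf_mult) (auto simp: suminf_geometric intro: summable_geometric)
  finally show "dist (g x) (g y) \<le> 1 / (1 - \<rho>) * dist x y"
    unfolding g_def using suminf_diff[OF sum] by (simp add: dist_norm)
qed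

text \<open>
  Averaging the series term by term shifts it by one index, so everything but \<open>h\<close> cancels. The
  interchange is justified by the geometric bound, uniform on \<open>[0, x + 1]\<close>.
\<close>

lemma g_stein_equation:
  assumes x: "0 \<le> x"
  shows "g x - avg_op t g (x + 1) = h x"
proof -
  have x1: "0 < x + 1" using x by simp
  interpret K: prob_space "kernel (x + 1)" by (rule kernel_prob)
  have int: "integrable (kernel (x + 1)) (\<lambda>v. avg_iter t h k (max 0 v))" for k
    using x by (intro kernel_integrable avg_iter_continuous) simp
  have bound: "(\<integral>v. norm (avg_iter t h k (max 0 v)) \<partial>kernel (x + 1)) \<le> (\<mu> + (x + 1)) * \<rho> ^ k" for k
  proof (rule K.integral_le_const)
    show "integrable (kernel (x + 1)) (\<lambda>v. norm (avg_iter t h k (max 0 v)))"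
      using int by simp
    show "AE v in kernel (x + 1). norm (avg_iter t h k (max 0 v)) \<le> (\<mu> + (x + 1)) * \<rho> ^ k"
      using AE_kernel[OF less_imp_le[OF x1]]
    proof eventually_elim
      case (elim v)
      then have "norm (avg_iter t h k (max 0 v)) \<le> (\<mu> + v) * \<rho> ^ k" using avg_iter_bound[of v k] by simp
      also have "\<dots> \<le> (\<mu> + (x + 1)) * \<rho> ^ k"
        using elim rho_nonneg by (intro mult_right_mono) auto
      finally show ?case .
    qed
  qed
  have "avg_op t g (x + 1) = (\<integral>v. (\<Sum>k. avg_iter t h k (max 0 v)) \<partial>kernel (x + 1))"
    using avg_op_kernel[OF x1 lipschitz_on_continuous_on[OF g_lipschitz]] by (simp add: g_def)
  also have "\<dots> = (\<Sum>k. \<integral>v. avg_iter t h k (max 0 v) \<partial>kernel (x + 1))"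
  proof (rule integral_suminf)
    show "AE v in kernel (x + 1). summable (\<lambda>k. norm (avg_iter t h k (max 0 v)))"
      using avg_iter_summable by simp
    show "summable (\<lambda>k. \<integral>v. norm (avg_iter t h k (max 0 v)) \<partial>kernel (x + 1))"
      by (rule summable_comparison_test'[OF geometric_summable[of "\<mu> + (x + 1)"]])
        (use bound in auto)
  qed (rule int)
  also have "\<dots> = (\<Sum>k. avg_iter t h (Suc k) x)"
    using avg_op_kernel[OF x1 avg_iter_continuous] by simp
  also have "\<dots> = g x - h x"
    unfolding g_def using suminf_split_head[OF summable_rabs_cancel[OF avg_iter_summable[OF x]]] by simp
  finally show ?thesis by simp
qed

end

theorem theorem4p7:
  fixes \<theta> \<mu> \<rho> a :: real and s t h g :: "real \<Rightarrow> real" and g_part :: "nat \<Rightarrow> real \<Rightarrow> real"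
    and M :: "'a measure" and D :: "'a \<Rightarrow> real"
  defines "t \<equiv> (\<lambda>x. s x powr \<theta>)"
    and "g_part \<equiv> (\<lambda>n x. \<Sum>k\<le>n. avg_iter t h k x)"
    and "g \<equiv> (\<lambda>x. \<Sum>k. avg_iter t h k x)"
    and "\<mu> \<equiv> (\<integral>w. D w \<partial>M)"
  assumes theta: "0 < \<theta>"
    and s_nonneg: "s \<in> {0..} \<rightarrow> {0..}"
    and s_ac: "locally_abs_cont s"
    and s_mono: "strict_mono_on {0..} s"
    and s_0: "s 0 = 0" and s_1: "s 1 = 1"
    and s_shift: "\<And>x. 0 \<le> x \<Longrightarrow> s (x + 1) \<le> s x + 1"
    and s_contr: "\<And>x y. 0 \<le> x \<Longrightarrow> 0 \<le> y \<Longrightarrow> \<bar>s (x + 1) - s (y + 1)\<bar> \<le> \<bar>s x - s y\<bar>"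
    and D: "perpetuity_rv \<theta> s M D"
    and mean: "integrable M D"
    and rho: "0 \<le> \<rho>" "\<rho> < 1"
    and I_bound: "esssup (lebesgue_on {0<..}) (\<lambda>x. ereal (ratio_I t x)) \<le> ereal \<rho>"
    and a: "0 \<le> a"
    and h_lip: "1-lipschitz_on {0..} h"
    and h_mean: "(\<integral>w. h (D w) \<partial>M) = 0"
  shows "(\<forall>k. (SUP x\<in>{0..a}. ereal \<bar>avg_iter t h k x\<bar>) \<le> ereal ((\<mu> + a) * \<rho> ^ k))
    \<and> (\<forall>n. ((1 - \<rho> ^ (n + 1)) / (1 - \<rho>))-lipschitz_on {0..} (g_part n))
    \<and> (\<forall>x\<ge>0. summable (\<lambda>k. avg_iter t h k x))
    \<and> (1 / (1 - \<rho>))-lipschitz_on {0..} g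
    \<and> (\<forall>x\<ge>0. g x - avg_op t g (x + 1) = h x - (\<integral>w. h (D w) \<partial>M))"
proof -
  interpret S: scale_function \<theta> s
    using theta s_ac s_mono s_0 by unfold_locales
  have t_eq: "t = S.t" by (simp add: fun_eq_iff t_def S.t_def)
  have "AE x in lebesgue_on {0<..}. ereal (ratio_I t x) \<le> ereal \<rho>"
    using esssup_AE[of "\<lambda>x. ereal (ratio_I t x)" "lebesgue_on {0<..}"]
    by (rule eventually_mono) (rule order_trans[OF _ I_bound])
  then have "AE x in lebesgue. x \<in> {0<..} \<longrightarrow> ereal (ratio_I t x) \<le> ereal \<rho>"
    by (subst (asm) AE_restrict_space_iff) auto
  then have "AE x in lborel. 0 < x \<longrightarrow> ratio_I S.t x \<le> \<rho>"
    by (simp add: AE_completion_iff t_eq)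
  then interpret P: centred_perpetuity \<theta> s \<rho> M D h
    using rho D mean h_lip h_mean by unfold_locales auto
  have mu_eq: "\<mu> = P.\<mu>" by (simp add: \<mu>_def P.\<mu>_def)
  have g_eq: "g = P.g" by (simp add: fun_eq_iff g_def P.g_def t_eq)
  have "(SUP x\<in>{0..a}. ereal \<bar>avg_iter t h k x\<bar>) \<le> ereal ((\<mu> + a) * \<rho> ^ k)" for k
  proof (rule SUP_least)
    fix x assume x: "x \<in> {0..a}"
    then have "\<bar>avg_iter t h k x\<bar> \<le> (\<mu> + x) * \<rho> ^ k"
      using P.avg_iter_bound by (simp add: t_eq mu_eq)
    also have "\<dots> \<le> (\<mu> + a) * \<rho> ^ k" using x rho by (intro mult_right_mono) auto
    finally show "ereal \<bar>avg_iter t h k x\<bar> \<le> ereal ((\<mu> + a) * \<rho> ^ k)" by simp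
  qed
  moreover have "((1 - \<rho> ^ (n + 1)) / (1 - \<rho>))-lipschitz_on {0..} (g_part n)" for n
    using P.partial_sum_lipschitz by (simp add: g_part_def t_eq)
  moreover have "summable (\<lambda>k. avg_iter t h k x)" if "0 \<le> x" for x
    using summable_rabs_cancel[OF P.avg_iter_summable[OF that]] by (simp add: t_eq)
  moreover have "(1 / (1 - \<rho>))-lipschitz_on {0..} g"
    using P.g_lipschitz by (simp add: g_eq)
  moreover have "g x - avg_op t g (x + 1) = h x - (\<integral>w. h (D w) \<partial>M)" if "0 \<le> x" for x
    using P.g_stein_equation[OF that] h_mean by (simp add: g_eq t_eq)
  ultimately show ?thesis by blast
qed

end
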